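(* Let $k\ge3$ and let $\mathscr{T}\in\mathbb{R}^{n_1\times n_2\times n_3\times\cdots\times n_k}$ be a tensor in the HTD format with leaf factor matrices $\mathbf{U}_t\in\mathbb{R}^{n_t\times r_t}$ and transfer tensors $\mathscr{B}_\tau$ with respect to a dimension tree $\mathcal{T}$ on $D=\{1,2,\dots,k\}$, where $\mathbf{U}_1$ and $\mathbf{U}_2$ have orthonormal columns. Assume that $\{1,2\}\in\mathcal{T}$ and that the modes $3,4,\dots,k$ form the complementary subtree (i.e. the root $D$ has children $\{1,2\}$ and $f=\{3,4,\dots,k\}$). For $t=3,\dots,k$ define $\widetilde{\mathbf{U}}_t=\mathbf{F}_{n_t}\mathbf{U}_t$. For each frequency tuple $\boldsymbol{j}=(j_3,\dots,j_k)$, $1\le j_t\le n_t$, let $\mathbf{G}_{\boldsymbol{j}}\in\mathbb{C}^{r_1\times r_2}$ be obtained by contracting the transformed HTD network with the rows $\widetilde{\mathbf{U}}_t(j_t,:)$, while leaving the rank indices associated with modes $1$ and $2$ open. Set $s=\max_{\boldsymbol{j}}\operatorname{rank}(\mathbf{G}_{\boldsymbol{j}})$ and let $\mathbf{G}_{\boldsymbol{j}}=\mathbf{U}_{\boldsymbol{j}}\boldsymbol{S}_{\boldsymbol{j}}(\mathbf{V}_{\boldsymbol{j}})^*$ be the compact SVD, padded with zero singular values (and orthonormal columns) to size $s$ if necessary, so that $\mathbf{U}_{\boldsymbol{j}}\in\mathbb{C}^{r_1\times s}$ and $\mathbf{V}_{\boldsymbol{j}}\in\mathbb{C}^{r_2\times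 s}$ have orthonormal columns and $\boldsymbol{S}_{\boldsymbol{j}}\in\mathbb{R}^{s\times s}$ is diagonal with nonnegative entries. Let $\mathcal{T}_{\mathscr{U}},\mathcal{T}_{\mathscr{S}},\mathcal{T}_{\mathscr{V}}$ be the HTD trees whose root $D$ has children $\{1,2\}$ and $f$, and which share the same subtree $\mathcal{T}_f$ on $f$. Define tensors $\mathscr{U}$ ($n_1\times s\times n_3\times\cdots\times n_k$), $\mathscr{S}$ ($s\times s\times n_3\times\cdots\times n_k$), $\mathscr{V}$ ($n_2\times s\times n_3\times\cdots\times n_k$) in HTD format on these trees as follows. Leaf factors: $$\mathbf{L}^{\mathscr{U}}_{\{1\}}=\mathbf{U}_1,\ \mathbf{L}^{\mathscr{U}}_{\{2\}}=\mathbf{I}_s;\quad \mathbf{L}^{\mathscr{S}}_{\{1\}}=\mathbf{I}_s,\ \mathbf{L}^{\mathscr{S}}_{\{2\}}=\mathbf{I}_s;\quad \mathbf{L}^{\mathscr{V}}_{\{1\}}=\mathbf{U}_2,\ \mathbf{L}^{\mathscr{V}}_{\{2\}}=\mathbf{I}_s;\quad \mathbf{L}^{\mathscr{U}}_{\{t\}}=\mathbf{L}^{\mathscr{S}}_{\{t\}}=\mathbf{L}^{\mathscr{V}}_{\{t\}}=\mathbf{F}_{n_t}^{-1},\ t=3,\dots,k.$$ With $\phi(a,b)=a+(b-1)p$, $a=1,\dots,p$ ($p$ the range of the first index), the transfer tensors at $\{1,2\}$ are $$\mathscr{B}^{\mathscr{U}}_{\{1,2\}}(\alpha_1,\xi,\phi(\alpha_1,\xi))=1,\quad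 \mathscr{B}^{\mathscr{S}}_{\{1,2\}}(\xi,\zeta,\phi(\xi,\zeta))=1,\quad \mathscr{B}^{\mathscr{V}}_{\{1,2\}}(\alpha_2,\zeta,\phi(\alpha_2,\zeta))=1,$$ for $\alpha_1=1,\dots,r_1$, $\alpha_2=1,\dots,r_2$, $\xi,\zeta=1,\dots,s$. For each leaf $\{t\}\subseteq f$ let $\rho_{\{t\}}=j_t$, and for each internal node $\tau\subseteq f$ with children $\tau_1,\tau_2$ let $\rho_\tau=\rho_{\tau_1}+\bigl(\prod_{\ell\in\tau_1}n_\ell\bigr)(\rho_{\tau_2}-1)$ and $\mathscr{B}^{\mathscr{X}}_\tau(\rho_{\tau_1},\rho_{\tau_2},\rho_\tau)=1$ for $\mathscr{X}\in\{\mathscr{U},\mathscr{S},\mathscr{V}\}$. The root transfer tensors are $$\mathscr{B}^{\mathscr{U}}_D(\phi(\alpha_1,\xi),\rho_f,1)=\mathbf{U}_{\boldsymbol{j}}(\alpha_1,\xi),\quad \mathscr{B}^{\mathscr{S}}_D(\phi(\xi,\zeta),\rho_f,1)=\boldsymbol{S}_{\boldsymbol{j}}(\xi,\zeta),\quad \mathscr{B}^{\mathscr{V}}_D(\phi(\alpha_2,\zeta),\rho_f,1)=\mathbf{V}_{\boldsymbol{j}}(\alpha_2,\zeta).$$ All unspecified entries of the transfer tensors are zero. Then these factor matrices and transfer tensors define HTD representations of the factor tensors $\mathscr{U},\mathscr{S},\mathscr{V}$ of a (compact) higher-order SVD of $\mathscr{T}$: $\mathscr{T}=\mathscr{U}\star_H\mathscr{S}\star_H\mathscr{V}^\top$,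 and for every $\boldsymbol{j}$ the Fourier-domain faces $\widetilde{\mathscr{U}}(:,:,\boldsymbol{j})$ and $\widetilde{\mathscr{V}}(:,:,\boldsymbol{j})$ have orthonormal columns and $\widetilde{\mathscr{S}}(:,:,\boldsymbol{j})$ is diagonal with nonnegative entries.
   Context: A dimension tree on $D=\{1,\dots,k\}$ is a rooted binary tree whose nodes are nonempty subsets of $D$, with root $D$, leaves the singletons $\{t\}$, and each internal node $\tau$ the disjoint union of its two (ordered) children $\tau_1,\tau_2$; the children of $\{1,2\}$ are $\{1\}$ and $\{2\}$. $\mathcal{T}_f$ is the subtree of $\mathcal{T}$ rooted at $f$ (a dimension tree on $f$; a single leaf if $k=3$). A $k$th-order tensor $\mathscr{X}$ of size $m_1\times\cdots\times m_k$ is in hierarchical Tucker (HTD) format with (real or complex) leaf factors $\mathbf{L}_{\{t\}}$ of size $m_t\times\rho'_{\{t\}}$ and transfer tensors $\mathscr{B}_\tau$ of size $\rho'_{\tau_1}\times\rho'_{\tau_2}\times\rho'_\tau$ ($\rho'_D=1$) if $$\mathscr{X}(i_1,\dots,i_k)=\sum_{(\alpha_\tau)_{\tau}}\ \prod_{\tau\text{ internal}}\mathscr{B}_\tau(\alpha_{\tau_1},\alpha_{\tau_2},\alpha_\tau)\ \prod_{t=1}^k\mathbf{L}_{\{t\}}(i_t,\alpha_{\{t\}}),\quad 1\le\alpha_\tau\le\rho'_\tau.$$ For $\mathscr{T}$ the leaf factors are $\mathbf{U}_t$ and the ranks are $r_\tau$ ($r_{\{t\}}=r_t$, $r_D=1$).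 Explicitly, $\mathbf{G}_{\boldsymbol{j}}(\alpha_{\{1\}},\alpha_{\{2\}})=\sum\prod_{\tau\text{ internal}}\mathscr{B}_\tau(\alpha_{\tau_1},\alpha_{\tau_2},\alpha_\tau)\prod_{t=3}^k\widetilde{\mathbf{U}}_t(j_t,\alpha_{\{t\}})$, summed over all rank indices $\alpha_\tau$ with $\tau\in\mathcal{T}\setminus\{\{1\},\{2\}\}$. In the HTD of $\mathscr{U},\mathscr{S},\mathscr{V}$, the rank at a node $\tau\subseteq f$ is $\prod_{\ell\in\tau}n_\ell$, and $\rho_f$ determines $\boldsymbol{j}$ uniquely. ($\mathbf{U}_1,\mathbf{U}_2$, indexed by modes, are leaf factors; $\mathbf{U}_{\boldsymbol{j}}$, indexed by a frequency tuple, are SVD factors.) Mode-$p$ multiplication: $(\mathscr{X}\times_p\mathbf{A})(\dots,i,\dots)=\sum_{j_p}\mathbf{A}(i,j_p)\mathscr{X}(\dots,j_p,\dots)$. $\mathbf{F}_n\in\mathbb{C}^{n\times n}$ is the discrete Fourier transform matrix $\mathbf{F}_n(p,q)=\frac{1}{\sqrt n}\omega^{(p-1)(q-1)}$, $\omega=\exp(-2\pi i/n)$. For any tensor $\mathscr{X}$ with modes $3,\dots,k$ of sizes $n_3,\dots,n_k$, $\widetilde{\mathscr{X}}=\mathscr{X}\times_3\mathbf{F}_{n_3}\times_4\cdots\times_k\mathbf{F}_{n_k}$. Facewise product: $(\mathscr{A}\,\Delta\,\mathscr{B})(:,:,j_3,\dots,j_k)=\mathscr{A}(:,:,j_3,\dots,j_k)\mathscr{B}(:,:,j_3,\dots,j_k)$.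 Higher-order tensor-tensor product: $\mathscr{A}\star_H\mathscr{B}=(\widetilde{\mathscr{A}}\,\Delta\,\widetilde{\mathscr{B}})\times_3\mathbf{F}_{n_3}^{-1}\times_4\cdots\times_k\mathbf{F}_{n_k}^{-1}$. The transpose $\mathscr{V}^\top$ is the tensor whose Fourier-domain faces are the conjugate transposes $\widetilde{\mathscr{V}}(:,:,\boldsymbol{j})^*$ of those of $\mathscr{V}$. *)

theory Defs
  imports
    "Jordan_Normal_Form.Schur_Decomposition"
    "Jordan_Normal_Form.Gauss_Jordan_Elimination"
    "Jordan_Normal_Form.DL_Rank"
    "HOL-Library.FuncSet"
begin

text \<open>
  Modes are numbered from 1 as usual, but every index running over a mode or a rank is 0-based,
  as in the matrix library: an index of range \<open>m\<close> runs through \<open>{..<m}\<close>.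
\<close>

section \<open>Tensors\<close>

text \<open>
  \<open>Tensor k m X\<close> is a tensor of order \<open>k\<close> and size \<open>m 1\<close> x ... x \<open>m k\<close>. Only its entries at the
  multi-indices in \<open>tindex\<close> are meaningful, and tensors are compared by \<open>tensor_eq\<close>.
\<close>

datatype 'a tensor =
  Tensor (torder: nat) (tsize: "nat \<Rightarrow> nat") (tentry: "(nat \<Rightarrow> nat) \<Rightarrow> 'a")

definition tensor_carrier :: "nat \<Rightarrow> (nat \<Rightarrow> nat) \<Rightarrow> 'a tensor set" where
  "tensor_carrier k m = {X. torder X = k \<and> (\<forall>t\<in>{1..k}. tsize X t = m t)}"

definition tindex :: "'a tensor \<Rightarrow> (nat \<Rightarrow> nat) set" where
  "tindex X = (\<Pi>\<^sub>E t\<in>{1..torder X}. {..<tsize X t})"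

definition tensor_eq :: "'a tensor \<Rightarrow> 'a tensor \<Rightarrow> bool" (infix \<open>\<doteq>\<close> 50) where
  "X \<doteq> Y \<longleftrightarrow> X \<in> tensor_carrier (torder Y) (tsize Y) \<and> (\<forall>i\<in>tindex Y. tentry X i = tentry Y i)"

definition mode_mult :: "nat \<Rightarrow> 'a::comm_semiring_0 mat \<Rightarrow> 'a tensor \<Rightarrow> 'a tensor" where
  "mode_mult p A X = Tensor (torder X) ((tsize X)(p := dim_row A))
     (\<lambda>i. \<Sum>j<dim_col A. A $$ (i p, j) * tentry X (i(p := j)))"

definition dft_mat :: "nat \<Rightarrow> complex mat" where
  "dft_mat m = mat m m (\<lambda>(p, q). complex_of_real (1 / sqrt (real m)) *
     exp (- (2 * complex_of_real pi * \<i>) / of_nat m) ^ (p * q))"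

definition dft_inv_mat :: "nat \<Rightarrow> complex mat" where
  "dft_inv_mat m = the (mat_inverse (dft_mat m))"

definition fourier :: "complex tensor \<Rightarrow> complex tensor" where
  "fourier X = fold (\<lambda>t. mode_mult t (dft_mat (tsize X t))) [3..<Suc (torder X)] X"

definition fourier_inv :: "complex tensor \<Rightarrow> complex tensor" where
  "fourier_inv X = fold (\<lambda>t. mode_mult t (dft_inv_mat (tsize X t))) [3..<Suc (torder X)] X"

definition freqs :: "nat \<Rightarrow> (nat \<Rightarrow> nat) \<Rightarrow> (nat \<Rightarrow> nat) set" where
  "freqs k n = (\<Pi>\<^sub>E t\<in>{3..k}. {..<n t})"

text \<open>\<open>face X j\<close> is the frontal slice \<open>X(:,:,j)\<close>, for \<open>j \<in> freqs (torder X) (tsize X)\<close>.\<close>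

definition face :: "'a tensor \<Rightarrow> (nat \<Rightarrow> nat) \<Rightarrow> 'a mat" where
  "face X j = mat (tsize X 1) (tsize X 2) (\<lambda>(a, b). tentry X (j(1 := a, 2 := b)))"

text \<open>The tensor with prescribed \<open>m\<close> x \<open>q\<close> faces \<open>A j\<close>, and mode sizes \<open>n 3, ..., n k\<close>.\<close>

definition tensor_of_faces ::
  "nat \<Rightarrow> (nat \<Rightarrow> nat) \<Rightarrow> nat \<Rightarrow> nat \<Rightarrow> ((nat \<Rightarrow> nat) \<Rightarrow> 'a mat) \<Rightarrow> 'a tensor" where
  "tensor_of_faces k n m q A =
     Tensor k (n(1 := m, 2 := q)) (\<lambda>i. A (restrict i {3..k}) $$ (i 1, i 2))"

definition facewise_mult :: "'a::semiring_0 tensor \<Rightarrow> 'a tensor \<Rightarrow> 'a tensor" where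
  "facewise_mult X Y = tensor_of_faces (torder X) (tsize X) (tsize X 1) (tsize Y 2)
     (\<lambda>j. face X j * face Y j)"

definition tprod :: "complex tensor \<Rightarrow> complex tensor \<Rightarrow> complex tensor"
    (infixl \<open>\<star>\<^sub>H\<close> 70) where
  "X \<star>\<^sub>H Y = fourier_inv (facewise_mult (fourier X) (fourier Y))"

definition ttranspose :: "complex tensor \<Rightarrow> complex tensor" where
  "ttranspose X = fourier_inv (tensor_of_faces (torder X) (tsize X) (tsize X 2) (tsize X 1)
     (\<lambda>j. mat_adjoint (face (fourier X) j)))"


section \<open>Dimension trees and the hierarchical Tucker format\<close>

datatype dtree = DLeaf nat | DNode dtree dtree

fun modes :: "dtree \<Rightarrow> nat set" where
  "modes (DLeaf t) = {t}"
| "modes (DNode l r) = modes l \<union> modes r"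

fun subtrees :: "dtree \<Rightarrow> dtree set" where
  "subtrees (DLeaf t) = {DLeaf t}"
| "subtrees (DNode l r) = insert (DNode l r) (subtrees l \<union> subtrees r)"

text \<open>
  The node of a dimension tree at the root of a subtree is the set of modes of that subtree.
  Disjointness of siblings makes distinct subtrees have distinct sets of modes.
\<close>

definition dimension_tree :: "nat set \<Rightarrow> dtree \<Rightarrow> bool" where
  "dimension_tree D T \<longleftrightarrow> modes T = D \<and>
     (\<forall>l r. DNode l r \<in> subtrees T \<longrightarrow> modes l \<inter> modes r = {})"

definition tree_nodes :: "dtree \<Rightarrow> nat set set" where
  "tree_nodes T = modes ` subtrees T"

text \<open>Internal nodes, listed with their children as triples \<open>(\<tau>, \<tau>\<^sub>1, \<tau>\<^sub>2)\<close>.\<close>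

definition internal_nodes :: "dtree \<Rightarrow> (nat set \<times> nat set \<times> nat set) set" where
  "internal_nodes T =
     {(modes (DNode l r), modes l, modes r) | l r. DNode l r \<in> subtrees T}"

type_synonym 'a transfer = "nat set \<Rightarrow> nat \<Rightarrow> nat \<Rightarrow> nat \<Rightarrow> 'a"

definition htd_entry ::
  "dtree \<Rightarrow> (nat set \<Rightarrow> nat) \<Rightarrow> (nat \<Rightarrow> 'a::comm_semiring_1 mat) \<Rightarrow> 'a transfer \<Rightarrow>
    (nat \<Rightarrow> nat) \<Rightarrow> 'a" where
  "htd_entry T \<rho> L B i =
     (\<Sum>\<alpha>\<in>(\<Pi>\<^sub>E \<tau>\<in>tree_nodes T. {..<\<rho> \<tau>}).
        (\<Prod>(\<tau>, \<tau>1, \<tau>2)\<in>internal_nodes T. B \<tau> (\<alpha> \<tau>1) (\<alpha> \<tau>2) (\<alpha> \<tau>)) *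
        (\<Prod>t\<in>modes T. L t $$ (i t, \<alpha> {t})))"

definition htd_tensor ::
  "nat \<Rightarrow> dtree \<Rightarrow> (nat set \<Rightarrow> nat) \<Rightarrow> (nat \<Rightarrow> 'a::comm_semiring_1 mat) \<Rightarrow> 'a transfer \<Rightarrow>
    'a tensor" where
  "htd_tensor k T \<rho> L B = Tensor k (\<lambda>t. dim_row (L t)) (htd_entry T \<rho> L B)"

definition htd_format ::
  "'a tensor \<Rightarrow> dtree \<Rightarrow> (nat set \<Rightarrow> nat) \<Rightarrow> (nat \<Rightarrow> 'a::comm_semiring_1 mat) \<Rightarrow> 'a transfer \<Rightarrow>
    bool" where
  "htd_format X T \<rho> L B \<longleftrightarrow>
     dimension_tree {1..torder X} T \<and>
     (\<forall>t\<in>{1..torder X}. L t \<in> carrier_mat (tsize X t) (\<rho> {t})) \<and>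
     \<rho> {1..torder X} = 1 \<and>
     (\<forall>i\<in>tindex X. tentry X i = htd_entry T \<rho> L B i)"

text \<open>
  Contraction of the network with the rows \<open>L t (j\<^sub>t, :)\<close> of the leaf factors of all modes other
  than 1 and 2, the rank indices at the leaves \<open>{1}\<close> and \<open>{2}\<close> being left open.
\<close>

definition htd_core ::
  "dtree \<Rightarrow> (nat set \<Rightarrow> nat) \<Rightarrow> (nat \<Rightarrow> 'a::comm_semiring_1 mat) \<Rightarrow> 'a transfer \<Rightarrow>
    (nat \<Rightarrow> nat) \<Rightarrow> 'a mat" where
  "htd_core T \<rho> L B j = mat (\<rho> {1}) (\<rho> {2}) (\<lambda>(a, b).
     \<Sum>\<alpha>\<in>(\<Pi>\<^sub>E \<tau>\<in>tree_nodes T - {{1}, {2}}. {..<\<rho> \<tau>}).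
       (let \<beta> = \<alpha>({1} := a, {2} := b) in
        (\<Prod>(\<tau>, \<tau>1, \<tau>2)\<in>internal_nodes T. B \<tau> (\<beta> \<tau>1) (\<beta> \<tau>2) (\<beta> \<tau>)) *
        (\<Prod>t\<in>modes T - {1, 2}. L t $$ (j t, \<beta> {t}))))"


section \<open>Orthonormality and singular value decompositions\<close>

definition orthonormal_cols :: "'a::conjugatable_field mat \<Rightarrow> bool" where
  "orthonormal_cols A \<longleftrightarrow>
     (\<forall>i<dim_col A. \<forall>j<dim_col A. col A i \<bullet>c col A j = (if i = j then 1 else 0))"

text \<open>
  A compact singular value decomposition of \<open>G\<close> padded to size \<open>s\<close>. Since \<open>U\<close> and \<open>V\<close> have
  orthonormal columns, exactly \<open>rank G\<close> diagonal entries of \<open>S\<close> are positive, the others being the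
  padding; neither the order of the singular values nor the position of the padding is prescribed.
\<close>

definition padded_svd ::
  "nat \<Rightarrow> complex mat \<Rightarrow> complex mat \<Rightarrow> real mat \<Rightarrow> complex mat \<Rightarrow> bool" where
  "padded_svd s G U S V \<longleftrightarrow>
     U \<in> carrier_mat (dim_row G) s \<and> orthonormal_cols U \<and>
     V \<in> carrier_mat (dim_col G) s \<and> orthonormal_cols V \<and>
     S \<in> carrier_mat s s \<and> diagonal_mat S \<and> (\<forall>i<s. 0 \<le> S $$ (i, i)) \<and>
     G = U * map_mat complex_of_real S * mat_adjoint V"


section \<open>HTD data of the factor tensors\<close>

text \<open>
  The three factors are instances of one construction with two parameters \<open>p\<close>, \<open>q\<close>, the ranks at
  the leaves \<open>{1}\<close> and \<open>{2}\<close>. Here \<open>Tf\<close> is the subtree on the modes \<open>3, ..., k\<close>.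
\<close>

definition pair_index :: "nat \<Rightarrow> nat \<times> nat \<Rightarrow> nat" where
  "pair_index p = (\<lambda>(a, b). a + b * p)"

text \<open>The rank index \<open>\<rho>\<^sub>\<tau>\<close> belonging to the frequencies \<open>j\<close>, for \<open>\<tau>\<close> the root of the given tree.\<close>

fun freq_index :: "(nat \<Rightarrow> nat) \<Rightarrow> dtree \<Rightarrow> (nat \<Rightarrow> nat) \<Rightarrow> nat" where
  "freq_index n (DLeaf t) j = j t"
| "freq_index n (DNode l r) j = freq_index n l j + (\<Prod>t\<in>modes l. n t) * freq_index n r j"

definition hosvd_rank :: "nat \<Rightarrow> (nat \<Rightarrow> nat) \<Rightarrow> nat \<Rightarrow> nat \<Rightarrow> nat set \<Rightarrow> nat" where
  "hosvd_rank k n p q \<tau> =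
     (if \<tau> = {1} then p
      else if \<tau> = {2} then q
      else if \<tau> = {1, 2} then p * q
      else if \<tau> = {1..k} then 1
      else \<Prod>t\<in>\<tau>. n t)"

definition hosvd_leaf ::
  "(nat \<Rightarrow> nat) \<Rightarrow> complex mat \<Rightarrow> complex mat \<Rightarrow> nat \<Rightarrow> complex mat" where
  "hosvd_leaf n L1 L2 t = (if t = 1 then L1 else if t = 2 then L2 else dft_inv_mat (n t))"

text \<open>
  The root transfer tensor places the entry \<open>(a, b)\<close> of \<open>M j\<close> at the position
  \<open>(pair_index p (a, b), freq_index n Tf j, 0)\<close>. Both index maps are injective on their domains and
  are inverted by \<open>the_inv_into\<close>.
\<close>

definition hosvd_transfer ::
  "nat \<Rightarrow> (nat \<Rightarrow> nat) \<Rightarrow> dtree \<Rightarrow> nat \<Rightarrow> nat \<Rightarrow> ((nat \<Rightarrow> nat) \<Rightarrow> complex mat) \<Rightarrow>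
    complex transfer" where
  "hosvd_transfer k n Tf p q M \<tau> x y z =
     (let P = {..<p} \<times> {..<q}; J = freqs k n in
      if \<tau> = {1, 2} then
        (if (x, y) \<in> P \<and> z = pair_index p (x, y) then 1 else 0)
      else if \<tau> = {1..k} then
        (if x \<in> pair_index p ` P \<and> y \<in> freq_index n Tf ` J \<and> z = 0
         then M (the_inv_into J (freq_index n Tf) y) $$ the_inv_into P (pair_index p) x
         else 0)
      else
        (if \<exists>l r. DNode l r \<in> subtrees Tf \<and> modes (DNode l r) = \<tau> \<and>
              (\<exists>j\<in>J. x = freq_index n l j \<and> y = freq_index n r j \<and>
                 z = freq_index n (DNode l r) j)
         then 1 else 0))"

end

theory Submission
  imports Defs
begin

text \<open>A tensor is determined by its frontal slices in the Fourier domain, and there \<open>\<star>\<^sub>H\<close> and the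
  transpose act slice by slice. The proposition therefore reduces to one matrix identity for every
  frequency tuple \<open>j\<close>, and what has to be computed are the Fourier slices of the four tensors, all
  of which are given by hierarchical Tucker networks on the same tree.

  If the rank indices at the leaves \<open>{1}\<close> and \<open>{2}\<close> are summed last, the slice at \<open>l\<close> of a network
  tensor is \<open>L\<^sub>1 C\<^sub>l L\<^sub>2\<^sup>T\<close>, where \<open>C\<^sub>l\<close> is the contraction of the rest of the network with the rows
  \<open>l\<^sub>t\<close> of the leaf factors \<open>L\<^sub>t\<close>. This contraction is linear in each of these rows, so the Fourier
  transform passes through it: the Fourier slice at \<open>j\<close> has the same form, with \<open>F L\<^sub>t\<close> in place of
  \<open>L\<^sub>t\<close> (\<open>face_fourier_htd_tensor\<close>). For the given tensor it is \<open>U\<^sub>1 G\<^sub>j U\<^sub>2\<^sup>T\<close>.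

  For the three factors \<open>L\<^sub>t = F\<^sup>-\<^sup>1\<close>, so the transformed leaf factors are identity matrices. Their
  rows \<open>j\<^sub>t\<close> force the rank index at every leaf \<open>{t}\<close> of the tail to be \<open>j\<^sub>t\<close>. The 0/1 transfer
  tensors propagate this towards the root: at each node the rank index must be the mixed radix code
  of the frequencies below it. A single assignment of rank indices survives, its weight is the
  corresponding entry of the matrix stored in the root transfer tensor, and the contraction returns
  exactly that matrix (\<open>htd_core_hosvd\<close>). So the Fourier slices of the factors are \<open>U\<^sub>1 U\<^sub>j\<close>, \<open>S\<^sub>j\<close>
  and \<open>U\<^sub>2 V\<^sub>j\<close>. The singular value decomposition of \<open>G\<^sub>j\<close> turns
  \<open>(U\<^sub>1 U\<^sub>j) S\<^sub>j (U\<^sub>2 V\<^sub>j)\<^sup>* = U\<^sub>1 (U\<^sub>j S\<^sub>j V\<^sub>j\<^sup>*) U\<^sub>2\<^sup>T\<close> into \<open>U\<^sub>1 G\<^sub>j U\<^sub>2\<^sup>T\<close>, and a product of matrices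
  with orthonormal columns has orthonormal columns.\<close>


section \<open>Sums over index tuples and matrix entries\<close>

lemma sum_PiE_insert:
  assumes "x \<notin> S"
  shows "(\<Sum>g\<in>Pi\<^sub>E (insert x S) F. f g) = (\<Sum>a\<in>F x. \<Sum>g\<in>Pi\<^sub>E S F. f (g(x := a)))"
  unfolding PiE_insert_eq sum.cartesian_product
  by (subst sum.reindex[OF inj_combinator[OF assms]]) (simp add: case_prod_unfold)

lemma mult_mat_entry:
  assumes "A \<in> carrier_mat p m" and "B \<in> carrier_mat m q" and "a < p" and "b < q"
  shows "(A * B) $$ (a, b) = (\<Sum>c<m. A $$ (a, c) * B $$ (c, b))"
  using assms by (auto simp: scalar_prod_def lessThan_atLeast0 intro!: sum.cong)

lemma triple_mult_entry:
  assumes "A \<in> carrier_mat p u" and "M \<in> carrier_mat u v" and "C \<in> carrier_mat q v"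
    and ab: "a < p" "b < q"
  shows "(A * M * transpose_mat C) $$ (a, b) =
    (\<Sum>c<u. \<Sum>d<v. A $$ (a, c) * M $$ (c, d) * C $$ (b, d))"
proof -
  have "(A * M * transpose_mat C) $$ (a, b) = (\<Sum>d<v. (A * M) $$ (a, d) * transpose_mat C $$ (d, b))"
    by (rule mult_mat_entry[OF _ _ ab]) (use assms in auto)
  also have "\<dots> = (\<Sum>d<v. \<Sum>c<u. A $$ (a, c) * M $$ (c, d) * C $$ (b, d))"
  proof (intro sum.cong refl)
    fix d assume "d \<in> {..<v}"
    then have d: "d < v" by simp
    show "(A * M) $$ (a, d) * transpose_mat C $$ (d, b) = (\<Sum>c<u. A $$ (a, c) * M $$ (c, d) * C $$ (b, d))"
      unfolding mult_mat_entry[OF assms(1,2) ab(1) d] sum_distrib_right using d ab assms(3) by simp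
  qed
  also have "\<dots> = (\<Sum>c<u. \<Sum>d<v. A $$ (a, c) * M $$ (c, d) * C $$ (b, d))" by (rule sum.swap)
  finally show ?thesis .
qed


section \<open>Adjoints and orthonormal columns\<close>

lemma mat_adjoint_carrier: "A \<in> carrier_mat p q \<Longrightarrow> mat_adjoint A \<in> carrier_mat q p"
  unfolding mat_adjoint_def carrier_mat_def by simp

lemma mat_adjoint_index:
  assumes "A \<in> carrier_mat p q" and "a < q" and "b < p"
  shows "mat_adjoint A $$ (a, b) = conjugate (A $$ (b, a))"
  using assms by (simp add: mat_adjoint_def mat_of_rows_def)

lemma mat_adjoint_mult:
  fixes A B :: "'a::conjugatable_field mat"
  assumes A: "A \<in> carrier_mat p m" and B: "B \<in> carrier_mat m q"
  shows "mat_adjoint (A * B) = mat_adjoint B * mat_adjoint A"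
proof (rule eq_matI)
  note AB = mult_carrier_mat[OF A B]
  note adj = mat_adjoint_carrier[OF A] mat_adjoint_carrier[OF B] mat_adjoint_carrier[OF AB]
  fix a b assume "a < dim_row (mat_adjoint B * mat_adjoint A)" "b < dim_col (mat_adjoint B * mat_adjoint A)"
  then have a: "a < q" and b: "b < p" using adj by auto
  show "mat_adjoint (A * B) $$ (a, b) = (mat_adjoint B * mat_adjoint A) $$ (a, b)"
    unfolding mat_adjoint_index[OF AB a b] mult_mat_entry[OF A B b a] mult_mat_entry[OF adj(2,1) a b]
    using a b by (simp add: mat_adjoint_index[OF A] mat_adjoint_index[OF B] conjugate_dist_mul
        mult.commute sum_conjugate)
qed (use A B mat_adjoint_carrier[OF A] mat_adjoint_carrier[OF B] mat_adjoint_carrier[OF mult_carrier_mat[OF A B]] in auto)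

text \<open>
  The entry \<open>(i, j)\<close> of \<open>A\<^sup>* A\<close> is the inner product of the columns \<open>j\<close> and \<open>i\<close>. The matrix form makes
  orthonormality stable under products by associativity alone.
\<close>

lemma orthonormal_cols_iff:
  fixes A :: "'a::conjugatable_field mat"
  assumes A: "A \<in> carrier_mat p q"
  shows "orthonormal_cols A \<longleftrightarrow> mat_adjoint A * A = 1\<^sub>m q"
proof -
  note adj = mat_adjoint_carrier[OF A]
  have entry: "(mat_adjoint A * A) $$ (i, j) = col A j \<bullet>c col A i" if "i < q" "j < q" for i j
    unfolding mult_mat_entry[OF adj A that] scalar_prod_def using that A
    by (auto simp: mat_adjoint_index[OF A] lessThan_atLeast0 mult.commute intro!: sum.cong)
  show ?thesis
  proof
    assume "orthonormal_cols A"
    then have "(mat_adjoint A * A) $$ (i, j) = (if i = j then 1 else 0)" if "i < q" "j < q" for i j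
      unfolding entry[OF that] using that A by (auto simp: orthonormal_cols_def)
    then show "mat_adjoint A * A = 1\<^sub>m q"
      using A adj by (intro eq_matI) (simp_all del: index_mult_mat(1))
  next
    assume eq: "mat_adjoint A * A = 1\<^sub>m q"
    show "orthonormal_cols A"
      unfolding orthonormal_cols_def using A by (auto simp: entry[symmetric] eq)
  qed
qed

lemma orthonormal_cols_mult:
  fixes A B :: "'a::conjugatable_field mat"
  assumes A: "A \<in> carrier_mat p m" and B: "B \<in> carrier_mat m q"
    and "orthonormal_cols A" and "orthonormal_cols B"
  shows "orthonormal_cols (A * B)"
proof -
  note adj = mat_adjoint_carrier[OF A] mat_adjoint_carrier[OF B]
  have "mat_adjoint (A * B) * (A * B) = mat_adjoint B * (mat_adjoint A * A) * B"
    unfolding mat_adjoint_mult[OF A B]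
    using assoc_mult_mat[OF adj(2,1) mult_carrier_mat[OF A B]] assoc_mult_mat[OF adj(1) A B]
      assoc_mult_mat[OF adj(2) mult_carrier_mat[OF adj(1) A] B] by simp
  also have "\<dots> = 1\<^sub>m q"
    using assms adj by (simp add: orthonormal_cols_iff[OF A] orthonormal_cols_iff[OF B])
  finally show ?thesis
    unfolding orthonormal_cols_iff[OF mult_carrier_mat[OF A B]] .
qed

lemma mat_adjoint_of_real:
  "mat_adjoint (map_mat complex_of_real A) = transpose_mat (map_mat complex_of_real A)"
proof (rule eq_matI)
  let ?A = "map_mat complex_of_real A"
  have A: "?A \<in> carrier_mat (dim_row A) (dim_col A)" by simp
  fix a b assume "a < dim_row (transpose_mat ?A)" "b < dim_col (transpose_mat ?A)"
  then show "mat_adjoint ?A $$ (a, b) = transpose_mat ?A $$ (a, b)"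
    by (simp add: mat_adjoint_index[OF A])
qed (simp_all add: mat_adjoint_def)

lemma orthonormal_cols_of_real:
  assumes "orthonormal_cols (A :: real mat)"
  shows "orthonormal_cols (map_mat complex_of_real A)"
proof -
  have "col (map_mat complex_of_real A) i \<bullet>c col (map_mat complex_of_real A) j =
      complex_of_real (col A i \<bullet>c col A j)" if "i < dim_col A" "j < dim_col A" for i j
    using that by (simp add: scalar_prod_def)
  with assms show ?thesis unfolding orthonormal_cols_def by simp
qed


section \<open>The discrete Fourier matrix\<close>

lemma dft_mat_carrier: "dft_mat m \<in> carrier_mat m m"
  by (simp add: dft_mat_def)

text \<open>
  The entry \<open>(p, q)\<close> of the product is \<open>1/m\<close> times a geometric sum of \<open>x = \<omega>\<^sup>p\<^sup>-\<^sup>q\<close>. As \<open>x\<close> is an \<open>m\<close>-th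
  root of unity and equals 1 only for \<open>p = q\<close>, the sum vanishes off the diagonal.
\<close>

lemma dft_mat_times_conjugate:
  assumes "m \<ge> 1"
  shows "dft_mat m * map_mat cnj (dft_mat m) = 1\<^sub>m m"
proof (rule eq_matI)
  fix p q assume pq: "p < dim_row (1\<^sub>m m :: complex mat)" "q < dim_col (1\<^sub>m m :: complex mat)"
  then have p: "p < m" and q: "q < m" by auto
  define w where "w = exp (- (2 * complex_of_real pi * \<i>) / of_nat m)"
  \<comment> \<open>Roots of unity are written as values of \<open>cis\<close>, which is injective
    on the angles \<open>2\<pi>d/m\<close> with \<open>d < m\<close>.\<close>
  have w_cis: "w ^ d = cnj (cis (2 * pi * real d / real m))" for d
  proof -
    have "w = cis (- (2 * pi / real m))"
      by (simp add: w_def cis_conv_exp mult.commute)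
    then show ?thesis by (simp add: DeMoivre cis_cnj mult_ac)
  qed
  have w_unit: "w * cnj w = 1"
    using w_cis[of 1] by (simp add: cis_cnj cis_mult)
  have w_pow: "w ^ m = 1"
    using assms by (simp add: w_cis)
  define x where "x = w ^ p * cnj (w ^ q)"
  have x_ne: "x \<noteq> 1" if "p \<noteq> q"
  proof
    assume x1: "x = 1"
    have "x * w ^ q = w ^ p * (w * cnj w) ^ q"
      by (simp add: x_def power_mult_distrib)
    with x1 have "w ^ q = w ^ p" by (simp add: w_unit)
    then have "cis (2 * pi * real q / real m) = cis (2 * pi * real p / real m)"
      by (simp only: w_cis complex_cnj_cancel_iff)
    with p q have "q = p"
      using bij_betw_roots_unity[of m] assms by (auto simp: bij_betw_def inj_on_def)
    with that show False by simp
  qed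
  have "x ^ m = (w ^ m) ^ p * cnj ((w ^ m) ^ q)"
    by (simp add: x_def power_mult_distrib mult.commute flip: power_mult)
  then have "x ^ m = 1" by (simp add: w_pow)
  then have geom: "(\<Sum>l<m. x ^ l) = 0" if "p \<noteq> q"
    using geometric_sum[OF x_ne[OF that], of m] by simp
  have "(dft_mat m * map_mat cnj (dft_mat m)) $$ (p, q) =
      (\<Sum>l<m. (complex_of_real (1 / sqrt (real m)) * w ^ (p * l)) *
        cnj (complex_of_real (1 / sqrt (real m)) * w ^ (l * q)))"
    using p q by (simp add: dft_mat_def scalar_prod_def w_def lessThan_atLeast0)
  also have "\<dots> = (\<Sum>l<m. (1 / of_nat m) * x ^ l)"
  proof (intro sum.cong refl)
    fix l
    have "complex_of_real (1 / sqrt (real m)) * complex_of_real (1 / sqrt (real m)) = 1 / of_nat m"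
      by (simp flip: of_real_mult)
    moreover have "x ^ l = w ^ (p * l) * cnj (w ^ (l * q))"
      unfolding x_def power_mult_distrib power_mult mult.commute[of l q] complex_cnj_power ..
    ultimately show "(complex_of_real (1 / sqrt (real m)) * w ^ (p * l)) *
        cnj (complex_of_real (1 / sqrt (real m)) * w ^ (l * q)) = (1 / of_nat m) * x ^ l"
      unfolding complex_cnj_mult complex_cnj_complex_of_real by (metis mult.assoc mult.left_commute)
  qed
  also have "\<dots> = (1 / of_nat m) * (\<Sum>l<m. x ^ l)" by (simp add: sum_distrib_left)
  also have "\<dots> = (if p = q then 1 else 0)"
  proof (cases "p = q")
    case True
    then have "x = 1" using w_unit by (simp add: x_def flip: power_mult_distrib)
    with True assms show ?thesis by simp
  qed (simp add: geom)
  finally show "(dft_mat m * map_mat cnj (dft_mat m)) $$ (p, q) = (1\<^sub>m m) $$ (p, q)"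
    using p q by simp
qed (simp_all add: dft_mat_def)

text \<open>
  The conjugate matrix is a witness that \<open>dft_mat m\<close> is a unit, so \<open>mat_inverse\<close> does not return its failure value.
\<close>

lemma dft_inv_mat_inverse:
  assumes "m \<ge> 1"
  shows "dft_inv_mat m \<in> carrier_mat m m"
    and "dft_mat m * dft_inv_mat m = 1\<^sub>m m"
    and "dft_inv_mat m * dft_mat m = 1\<^sub>m m"
proof -
  let ?C = "map_mat cnj (dft_mat m)"
  have C: "?C \<in> carrier_mat m m" using dft_mat_carrier by simp
  have "dft_mat m \<in> Units (ring_mat TYPE(complex) m ())"
    using dft_mat_carrier C dft_mat_times_conjugate[OF assms]
      mat_mult_left_right_inverse[OF dft_mat_carrier C dft_mat_times_conjugate[OF assms]]
    unfolding Units_def ring_mat_simps by blast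
  then obtain W where "mat_inverse (dft_mat m) = Some W"
    using mat_inverse(1)[OF dft_mat_carrier, of m "()"]
    by (cases "mat_inverse (dft_mat m)") simp_all
  with mat_inverse(2)[OF dft_mat_carrier this]
  show "dft_inv_mat m \<in> carrier_mat m m"
    and "dft_mat m * dft_inv_mat m = 1\<^sub>m m"
    and "dft_inv_mat m * dft_mat m = 1\<^sub>m m"
    by (auto simp: dft_inv_mat_def)
qed


section \<open>Tensors and their frontal slices\<close>

text \<open>
  Tensors with \<open>p\<close> x \<open>q\<close> slices. The function \<open>n\<close> serves for all factors at once: its values
  at the modes 1 and 2 are overridden, and frequency tuples depend only on the remaining ones.
\<close>

abbreviation (input) faced :: "nat \<Rightarrow> (nat \<Rightarrow> nat) \<Rightarrow> nat \<Rightarrow> nat \<Rightarrow> 'a tensor set" where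
  "faced k n p q \<equiv> tensor_carrier k (n(1 := p, 2 := q))"

lemma facedD:
  assumes "X \<in> faced k n p q" and "k \<ge> 2"
  shows "torder X = k" and "tsize X 1 = p" and "tsize X 2 = q"
    and "\<And>t. t \<in> {3..k} \<Longrightarrow> tsize X t = n t"
  using assms by (auto simp: tensor_carrier_def)

lemma freqs_faced:
  assumes "X \<in> faced k n p q"
  shows "freqs k (tsize X) = freqs k n"
  unfolding freqs_def using assms by (intro PiE_cong) (auto simp: tensor_carrier_def)

lemma finite_freqs: "finite (freqs k n)"
  by (simp add: freqs_def finite_PiE)

lemma freqs_less: "j \<in> freqs k n \<Longrightarrow> t \<in> {3..k} \<Longrightarrow> j t < n t"
  unfolding freqs_def by (drule PiE_mem) auto

lemma override_on_freqs:
  assumes "j \<in> freqs k n" and "l \<in> freqs k n"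
  shows "override_on (j(1 := a, 2 := b)) l {3..k} = l(1 := a, 2 := b)"
proof
  fix t
  show "override_on (j(1 := a, 2 := b)) l {3..k} t = (l(1 := a, 2 := b)) t"
    using assms PiE_arb[of j "{3..k}" _ t] PiE_arb[of l "{3..k}" _ t]
    unfolding freqs_def override_on_def by (cases "t \<in> {3..k}") simp_all
qed

lemma face_index:
  assumes "X \<in> faced k n p q" and "k \<ge> 2" and "a < p" and "b < q"
  shows "face X j $$ (a, b) = tentry X (j(1 := a, 2 := b))"
  using assms facedD(2,3)[OF assms(1,2)] by (simp add: face_def)

lemma face_carrier:
  assumes "X \<in> faced k n p q" and "k \<ge> 2"
  shows "face X j \<in> carrier_mat p q"
  using facedD(2,3)[OF assms] by (simp add: face_def)

text \<open>
  A multi-index splits into its frequency part and the two indices within a slice.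
\<close>

lemma tensor_eqI_faces:
  assumes "X \<in> faced k n p q" and "Y \<in> faced k n p q" and "k \<ge> 2"
    and faces: "\<And>j. j \<in> freqs k n \<Longrightarrow> face X j = face Y j"
  shows "X \<doteq> Y"
  unfolding tensor_eq_def
proof (intro conjI ballI)
  show "X \<in> tensor_carrier (torder Y) (tsize Y)"
    using assms by (auto simp: tensor_carrier_def)
  fix i assume i: "i \<in> tindex Y"
  let ?j = "restrict i {3..k}"
  have ts: "tsize Y t = n t" if "t \<in> {3..k}" for t using facedD(4)[OF assms(2,3) that] .
  have iE: "i \<in> (\<Pi>\<^sub>E t\<in>{1..k}. {..<tsize Y t})"
    using i facedD(1)[OF assms(2,3)] by (simp add: tindex_def)
  have j: "?j \<in> freqs k n"
    unfolding freqs_def restrict_PiE_iff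
  proof
    fix t assume t: "t \<in> {3..k}"
    then have "t \<in> {1..k}" by auto
    from PiE_mem[OF iE this] show "i t \<in> {..<n t}" using ts[OF t] by simp
  qed
  have i1: "i 1 < p" and i2: "i 2 < q"
    using PiE_mem[OF iE, of 1] PiE_mem[OF iE, of 2] \<open>k \<ge> 2\<close> facedD(2,3)[OF assms(2,3)] by auto
  have "?j(1 := i 1, 2 := i 2) = i"
  proof
    fix t
    show "(?j(1 := i 1, 2 := i 2)) t = i t"
    proof (cases "t \<in> {1..k}")
      case True
      then show ?thesis by (cases "t = 1 \<or> t = 2") (auto simp: restrict_def)
    next
      case False
      then show ?thesis using PiE_arb[OF iE False] \<open>k \<ge> 2\<close> by (auto simp: restrict_def)
    qed
  qed
  then show "tentry X i = tentry Y i"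
    using face_index[OF assms(1,3) i1 i2, of ?j] face_index[OF assms(2,3) i1 i2, of ?j] faces[OF j]
    by simp
qed

lemma tensor_eq_trans:
  assumes "X \<doteq> Y" and "Y \<doteq> Z"
  shows "X \<doteq> Z"
proof -
  have "tindex Y = tindex Z"
    unfolding tindex_def using assms(2) by (auto simp: tensor_eq_def tensor_carrier_def intro!: PiE_cong)
  with assms show ?thesis by (simp add: tensor_eq_def tensor_carrier_def)
qed


section \<open>The Fourier transform acts on frontal slices\<close>

lemma override_on_fun_upd_eq:
  assumes "t \<notin> S"
  shows "override_on (i(t := c)) l S = override_on i (l(t := c)) (insert t S)"
  using assms by (auto simp: override_on_def fun_eq_iff)

text \<open>
  The induction removes the last multiplication. Its summation index replaces the entry of \<open>i\<close> at this
  mode before the other modes are expanded, and they leave that entry alone.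
\<close>

lemma fold_mode_mult_entry:
  assumes "distinct ts"
  shows "tentry (fold (\<lambda>t. mode_mult t (A t)) ts X) i =
    (\<Sum>l\<in>(\<Pi>\<^sub>E t\<in>set ts. {..<dim_col (A t)}).
       (\<Prod>t\<in>set ts. A t $$ (i t, l t)) * tentry X (override_on i l (set ts)))"
  using assms
proof (induction ts arbitrary: i rule: rev_induct)
  case Nil
  show ?case by simp
next
  case (snoc t ts)
  let ?P = "\<Pi>\<^sub>E t\<in>set ts. {..<dim_col (A t)}"
  have t: "t \<notin> set ts" and d: "distinct ts" using snoc.prems by auto
  have "tentry (fold (\<lambda>t. mode_mult t (A t)) (ts @ [t]) X) i =
    (\<Sum>c<dim_col (A t). \<Sum>l\<in>?P. A t $$ (i t, c) *
       ((\<Prod>u\<in>set ts. A u $$ ((i(t := c)) u, l u)) * tentry X (override_on (i(t := c)) l (set ts))))"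
    by (simp add: mode_mult_def snoc.IH[OF d] sum_distrib_left del: fun_upd_apply)
  also have "\<dots> = (\<Sum>c<dim_col (A t). \<Sum>l\<in>?P.
       (\<Prod>u\<in>insert t (set ts). A u $$ (i u, (l(t := c)) u)) *
       tentry X (override_on i (l(t := c)) (insert t (set ts))))"
  proof (intro sum.cong refl)
    fix c l
    have "(\<Prod>u\<in>set ts. A u $$ ((i(t := c)) u, l u)) = (\<Prod>u\<in>set ts. A u $$ (i u, (l(t := c)) u))"
      using t by (intro prod.cong) auto
    then show "A t $$ (i t, c) *
       ((\<Prod>u\<in>set ts. A u $$ ((i(t := c)) u, l u)) * tentry X (override_on (i(t := c)) l (set ts))) =
      (\<Prod>u\<in>insert t (set ts). A u $$ (i u, (l(t := c)) u)) *
       tentry X (override_on i (l(t := c)) (insert t (set ts)))"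
      using t by (simp add: override_on_fun_upd_eq mult.assoc)
  qed
  finally show ?case
    by (simp add: sum_PiE_insert[OF t, where F = "\<lambda>u. {..<dim_col (A u)}"])
qed

lemma fold_mode_mult_size:
  assumes "\<forall>t\<in>set ts. dim_row (A t) = tsize X t"
  shows "torder (fold (\<lambda>t. mode_mult t (A t)) ts X) = torder X"
    and "tsize (fold (\<lambda>t. mode_mult t (A t)) ts X) = tsize X"
proof -
  have "torder (fold (\<lambda>t. mode_mult t (A t)) ts X) = torder X \<and>
    tsize (fold (\<lambda>t. mode_mult t (A t)) ts X) = tsize X"
    using assms by (induction ts arbitrary: X) (auto simp: mode_mult_def fun_upd_idem)
  then show "torder (fold (\<lambda>t. mode_mult t (A t)) ts X) = torder X"
    and "tsize (fold (\<lambda>t. mode_mult t (A t)) ts X) = tsize X" by auto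
qed

text \<open>
  Multiplications along distinct modes commute with evaluation at the other modes, so together they
  act on slices as the matrix with the product entries \<open>\<Prod>\<^sub>t A\<^sub>t(j\<^sub>t, l\<^sub>t)\<close>, the Kronecker product of
  the \<open>A\<^sub>t\<close>.
\<close>

lemma face_fold_mode_mult:
  assumes X: "X \<in> faced k n p q" and k: "k \<ge> 2"
    and A: "\<And>t. t \<in> {3..k} \<Longrightarrow> A t \<in> carrier_mat (n t) (n t)"
  defines "Y \<equiv> fold (\<lambda>t. mode_mult t (A t)) [3..<Suc k] X"
  shows "Y \<in> faced k n p q"
    and "j \<in> freqs k n \<Longrightarrow> a < p \<Longrightarrow> b < q \<Longrightarrow> face Y j $$ (a, b) =
      (\<Sum>l\<in>freqs k n. (\<Prod>t\<in>{3..k}. A t $$ (j t, l t)) * face X l $$ (a, b))"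
proof -
  have set: "set [3..<Suc k] = {3..k}" by auto
  have "\<forall>t\<in>set [3..<Suc k]. dim_row (A t) = tsize X t"
    using A facedD(4)[OF X k] unfolding set by force
  note size = fold_mode_mult_size[OF this]
  show Y: "Y \<in> faced k n p q"
    using X unfolding Y_def tensor_carrier_def mem_Collect_eq size .
  assume j: "j \<in> freqs k n" and ab: "a < p" "b < q"
  have fr: "(\<Pi>\<^sub>E t\<in>{3..k}. {..<dim_col (A t)}) = freqs k n"
    unfolding freqs_def using A by (intro PiE_cong) auto
  have "face Y j $$ (a, b) = (\<Sum>l\<in>freqs k n.
      (\<Prod>t\<in>{3..k}. A t $$ ((j(1 := a, 2 := b)) t, l t)) *
      tentry X (override_on (j(1 := a, 2 := b)) l {3..k}))"
    unfolding face_index[OF Y k ab] unfolding Y_def fold_mode_mult_entry[OF distinct_upt] set fr ..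
  also have "\<dots> = (\<Sum>l\<in>freqs k n. (\<Prod>t\<in>{3..k}. A t $$ (j t, l t)) * face X l $$ (a, b))"
    by (intro sum.cong refl arg_cong2[where f = "(*)"] prod.cong)
      (simp_all only: override_on_freqs[OF j] face_index[OF X k ab], auto)
  finally show "face Y j $$ (a, b) = \<dots>" .
qed

lemma fourier_eq_fold:
  assumes X: "X \<in> faced k n p q" and k: "k \<ge> 2"
  shows "fourier X = fold (\<lambda>t. mode_mult t (dft_mat (n t))) [3..<Suc k] X"
    and "fourier_inv X = fold (\<lambda>t. mode_mult t (dft_inv_mat (n t))) [3..<Suc k] X"
proof -
  have size: "tsize X t = n t" if "t \<in> set [3..<Suc k]" for t
    by (rule facedD(4)[OF X k]) (use that in auto)
  have "fold (\<lambda>t. mode_mult t (F (tsize X t))) [3..<Suc k] X =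
      fold (\<lambda>t. mode_mult t (F (n t))) [3..<Suc k] X" for F :: "nat \<Rightarrow> complex mat"
    by (rule List.fold_cong) (simp_all only: size)
  then show "fourier X = fold (\<lambda>t. mode_mult t (dft_mat (n t))) [3..<Suc k] X"
    and "fourier_inv X = fold (\<lambda>t. mode_mult t (dft_inv_mat (n t))) [3..<Suc k] X"
    unfolding fourier_def fourier_inv_def facedD(1)[OF X k] by blast+
qed

lemma fourier_faced:
  assumes X: "X \<in> faced k n p q" and k: "k \<ge> 2"
  shows "fourier X \<in> faced k n p q"
  unfolding fourier_eq_fold[OF assms]
  by (rule face_fold_mode_mult(1)[OF assms dft_mat_carrier])

lemma face_fourier:
  assumes "X \<in> faced k n p q" and "k \<ge> 2" and "j \<in> freqs k n" and "a < p" and "b < q"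
  shows "face (fourier X) j $$ (a, b) =
    (\<Sum>l\<in>freqs k n. (\<Prod>t\<in>{3..k}. dft_mat (n t) $$ (j t, l t)) * face X l $$ (a, b))"
  unfolding fourier_eq_fold[OF assms(1,2)]
  by (rule face_fold_mode_mult(2)[OF assms(1,2) dft_mat_carrier assms(3-)])

lemma fourier_inv_faced:
  assumes X: "X \<in> faced k n p q" and k: "k \<ge> 2" and n: "\<forall>t\<in>{3..k}. n t \<ge> 1"
  shows "fourier_inv X \<in> faced k n p q"
  unfolding fourier_eq_fold[OF assms(1,2)]
  using n by (intro face_fold_mode_mult(1)[OF assms(1,2)] dft_inv_mat_inverse(1)) blast

lemma face_fourier_inv:
  assumes "X \<in> faced k n p q" and "k \<ge> 2" and n: "\<forall>t\<in>{3..k}. n t \<ge> 1"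
    and "j \<in> freqs k n" and "a < p" and "b < q"
  shows "face (fourier_inv X) j $$ (a, b) =
    (\<Sum>l\<in>freqs k n. (\<Prod>t\<in>{3..k}. dft_inv_mat (n t) $$ (j t, l t)) * face X l $$ (a, b))"
  unfolding fourier_eq_fold[OF assms(1,2)]
  using n by (intro face_fold_mode_mult(2)[OF assms(1,2) _ assms(4-)] dft_inv_mat_inverse(1)) blast

text \<open>
  The mixed product rule for Kronecker products: expanding a product of sums over the modes gives a
  sum over frequency tuples.
\<close>

lemma prod_mult_mat_entry:
  fixes A B :: "nat \<Rightarrow> 'a::comm_semiring_1 mat"
  assumes A: "\<And>t. t \<in> {3..k} \<Longrightarrow> A t \<in> carrier_mat (n t) (n t)"
    and B: "\<And>t. t \<in> {3..k} \<Longrightarrow> B t \<in> carrier_mat (n t) (m t)"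
    and j: "j \<in> freqs k n" and c: "\<And>t. t \<in> {3..k} \<Longrightarrow> c t < m t"
  shows "(\<Prod>t\<in>{3..k}. (A t * B t) $$ (j t, c t)) =
    (\<Sum>l\<in>freqs k n. (\<Prod>t\<in>{3..k}. A t $$ (j t, l t)) * (\<Prod>t\<in>{3..k}. B t $$ (l t, c t)))"
proof -
  have "(\<Prod>t\<in>{3..k}. (A t * B t) $$ (j t, c t)) =
    (\<Prod>t\<in>{3..k}. \<Sum>u<n t. A t $$ (j t, u) * B t $$ (u, c t))"
    by (intro prod.cong refl mult_mat_entry[OF A B]) (use freqs_less[OF j] c in auto)
  also have "\<dots> = (\<Sum>l\<in>freqs k n. \<Prod>t\<in>{3..k}. A t $$ (j t, l t) * B t $$ (l t, c t))"
    unfolding freqs_def by (rule prod_sum_PiE) auto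
  finally show ?thesis by (simp add: prod.distrib)
qed

lemma prod_one_mat_freqs:
  assumes "j \<in> freqs k n" and "l \<in> freqs k n"
  shows "(\<Prod>t\<in>{3..k}. (1\<^sub>m (n t) :: 'a::comm_semiring_1 mat) $$ (j t, l t)) = (if l = j then 1 else 0)"
proof (cases "l = j")
  case True
  then show ?thesis using freqs_less[OF assms(1)] by (auto intro!: prod.neutral)
next
  case False
  then obtain t where t: "t \<in> {3..k}" "j t \<noteq> l t"
    using assms PiE_ext[of j "{3..k}" _ l] unfolding freqs_def by metis
  then have "(1\<^sub>m (n t) :: 'a mat) $$ (j t, l t) = 0"
    using freqs_less[OF assms(1)] freqs_less[OF assms(2)] by simp
  with t False show ?thesis by (auto intro!: prod_zero)
qed

text \<open>
  The Kronecker product of inverse matrices is the inverse of the Kronecker product.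
\<close>

lemma sum_kernel_inverse:
  fixes f :: "(nat \<Rightarrow> nat) \<Rightarrow> 'a::comm_semiring_1"
  assumes A: "\<And>t. t \<in> {3..k} \<Longrightarrow> A t \<in> carrier_mat (n t) (n t)"
    and B: "\<And>t. t \<in> {3..k} \<Longrightarrow> B t \<in> carrier_mat (n t) (n t)"
    and AB: "\<And>t. t \<in> {3..k} \<Longrightarrow> A t * B t = 1\<^sub>m (n t)" and j: "j \<in> freqs k n"
  shows "(\<Sum>l\<in>freqs k n. (\<Prod>t\<in>{3..k}. A t $$ (j t, l t)) *
    (\<Sum>m\<in>freqs k n. (\<Prod>t\<in>{3..k}. B t $$ (l t, m t)) * f m)) = f j" (is "?L = _")
proof -
  have "?L = (\<Sum>m\<in>freqs k n. (\<Sum>l\<in>freqs k n. (\<Prod>t\<in>{3..k}. A t $$ (j t, l t)) *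
      (\<Prod>t\<in>{3..k}. B t $$ (l t, m t))) * f m)"
    unfolding sum_distrib_left sum_distrib_right mult.assoc by (rule sum.swap)
  also have "\<dots> = (\<Sum>m\<in>freqs k n. (if m = j then 1 else 0) * f m)"
  proof (intro sum.cong refl arg_cong2[where f = "(*)"])
    fix m assume m: "m \<in> freqs k n"
    have "(\<Sum>l\<in>freqs k n. (\<Prod>t\<in>{3..k}. A t $$ (j t, l t)) * (\<Prod>t\<in>{3..k}. B t $$ (l t, m t))) =
      (\<Prod>t\<in>{3..k}. (A t * B t) $$ (j t, m t))"
      by (rule prod_mult_mat_entry[OF A B j, symmetric]) (use freqs_less[OF m] in auto)
    also have "\<dots> = (\<Prod>t\<in>{3..k}. (1\<^sub>m (n t)) $$ (j t, m t))"
      by (intro prod.cong refl) (simp add: AB)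
    finally show "(\<Sum>l\<in>freqs k n. (\<Prod>t\<in>{3..k}. A t $$ (j t, l t)) *
        (\<Prod>t\<in>{3..k}. B t $$ (l t, m t))) = (if m = j then 1 else 0)"
      by (simp only: prod_one_mat_freqs[OF j m])
  qed
  also have "\<dots> = f j" using j finite_freqs by (simp add: if_distrib[of "\<lambda>x. x * _"] cong: if_cong)
  finally show ?thesis .
qed

text \<open>
  Both compositions multiply every mode by mutually inverse matrices, in one order or the other.
\<close>

lemma face_fourier_fourier_inv:
  assumes X: "X \<in> faced k n p q" and k: "k \<ge> 2" and n: "\<forall>t\<in>{3..k}. n t \<ge> 1"
    and j: "j \<in> freqs k n"
  shows "face (fourier (fourier_inv X)) j = face X j"
    and "face (fourier_inv (fourier X)) j = face X j"
proof -
  note FiX = fourier_inv_faced[OF X k n] and FX = fourier_faced[OF X k]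
  have dims: "face (fourier (fourier_inv X)) j \<in> carrier_mat p q"
    "face (fourier_inv (fourier X)) j \<in> carrier_mat p q" "face X j \<in> carrier_mat p q"
    using face_carrier[OF fourier_faced[OF FiX k] k] face_carrier[OF fourier_inv_faced[OF FX k n] k]
      face_carrier[OF X k] by auto
  show "face (fourier (fourier_inv X)) j = face X j"
  proof (rule eq_matI)
    fix a b assume "a < dim_row (face X j)" "b < dim_col (face X j)"
    then have ab: "a < p" "b < q" using dims by auto
    show "face (fourier (fourier_inv X)) j $$ (a, b) = face X j $$ (a, b)"
      unfolding face_fourier[OF FiX k j ab]
      using sum_kernel_inverse[of k "\<lambda>t. dft_mat (n t)" n "\<lambda>t. dft_inv_mat (n t)" j "\<lambda>m. face X m $$ (a, b)"]
        n j dft_mat_carrier dft_inv_mat_inverse by (simp add: face_fourier_inv[OF X k n _ ab])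
  qed (use dims in auto)
  show "face (fourier_inv (fourier X)) j = face X j"
  proof (rule eq_matI)
    fix a b assume "a < dim_row (face X j)" "b < dim_col (face X j)"
    then have ab: "a < p" "b < q" using dims by auto
    show "face (fourier_inv (fourier X)) j $$ (a, b) = face X j $$ (a, b)"
      unfolding face_fourier_inv[OF FX k n j ab]
      using sum_kernel_inverse[of k "\<lambda>t. dft_inv_mat (n t)" n "\<lambda>t. dft_mat (n t)" j "\<lambda>m. face X m $$ (a, b)"]
        n j dft_mat_carrier dft_inv_mat_inverse by (simp add: face_fourier[OF X k _ ab])
  qed (use dims in auto)
qed

lemma tensor_of_faces_faced:
  assumes "\<And>t. t \<in> {3..k} \<Longrightarrow> m t = n t"
  shows "tensor_of_faces k m p q A \<in> faced k n p q"
  using assms by (auto simp: tensor_of_faces_def tensor_carrier_def)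

lemma face_tensor_of_faces:
  assumes j: "j \<in> freqs k n" and A: "A j \<in> carrier_mat p q" and k: "k \<ge> 2"
  shows "face (tensor_of_faces k n p q A) j = A j"
proof (rule eq_matI)
  have F: "tensor_of_faces k n p q A \<in> faced k n p q" by (rule tensor_of_faces_faced) simp
  fix a b assume "a < dim_row (A j)" "b < dim_col (A j)"
  then have ab: "a < p" "b < q" using A by auto
  have "restrict (j(1 := a, 2 := b)) {3..k} = j"
    using j PiE_arb[of j "{3..k}"] by (simp add: freqs_def fun_eq_iff restrict_def)
  then show "face (tensor_of_faces k n p q A) j $$ (a, b) = A j $$ (a, b)"
    unfolding face_index[OF F k ab] by (simp add: tensor_of_faces_def)
qed (use A face_carrier[OF tensor_of_faces_faced[of k n n p q A] k, of j] in auto)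

lemma face_facewise_mult:
  assumes X: "X \<in> faced k n p u" and Y: "Y \<in> faced k n u q" and k: "k \<ge> 2"
  shows "facewise_mult X Y \<in> faced k n p q"
    and "j \<in> freqs k n \<Longrightarrow> face (facewise_mult X Y) j = face X j * face Y j"
proof -
  have eq: "facewise_mult X Y = tensor_of_faces k (tsize X) p q (\<lambda>j. face X j * face Y j)"
    using facedD[OF X k] facedD[OF Y k] by (simp add: facewise_mult_def)
  show "facewise_mult X Y \<in> faced k n p q"
    unfolding eq by (rule tensor_of_faces_faced) (rule facedD(4)[OF X k])
  assume "j \<in> freqs k n"
  then show "face (facewise_mult X Y) j = face X j * face Y j"
    unfolding eq using mult_carrier_mat[OF face_carrier[OF X k] face_carrier[OF Y k]] k
      freqs_faced[OF X]
    by (intro face_tensor_of_faces) auto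
qed

text \<open>
  The inverse transform in the definition of the product is undone, which leaves the facewise product.
  This is why nested products can be evaluated slice by slice.
\<close>

lemma face_fourier_tprod:
  assumes X: "X \<in> faced k n p u" and Y: "Y \<in> faced k n u q" and k: "k \<ge> 2"
    and n: "\<forall>t\<in>{3..k}. n t \<ge> 1"
  shows "X \<star>\<^sub>H Y \<in> faced k n p q"
    and "j \<in> freqs k n \<Longrightarrow> face (fourier (X \<star>\<^sub>H Y)) j = face (fourier X) j * face (fourier Y) j"
proof -
  note F = face_facewise_mult[OF fourier_faced[OF X k] fourier_faced[OF Y k] k]
  show "X \<star>\<^sub>H Y \<in> faced k n p q"
    unfolding tprod_def by (rule fourier_inv_faced[OF F(1) k n])
  assume j: "j \<in> freqs k n"
  show "face (fourier (X \<star>\<^sub>H Y)) j = face (fourier X) j * face (fourier Y) j"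
    unfolding tprod_def face_fourier_fourier_inv(1)[OF F(1) k n j] by (rule F(2)[OF j])
qed

lemma face_fourier_ttranspose:
  assumes X: "X \<in> faced k n p q" and k: "k \<ge> 2"
    and n: "\<forall>t\<in>{3..k}. n t \<ge> 1"
  shows "ttranspose X \<in> faced k n q p"
    and "j \<in> freqs k n \<Longrightarrow> face (fourier (ttranspose X)) j = mat_adjoint (face (fourier X) j)"
proof -
  let ?Z = "tensor_of_faces k (tsize X) q p (\<lambda>j. mat_adjoint (face (fourier X) j))"
  have eq: "ttranspose X = fourier_inv ?Z"
    using facedD[OF X k] by (simp add: ttranspose_def)
  have Z: "?Z \<in> faced k n q p"
    by (rule tensor_of_faces_faced) (rule facedD(4)[OF X k])
  show "ttranspose X \<in> faced k n q p" unfolding eq by (rule fourier_inv_faced[OF Z k n])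
  assume j: "j \<in> freqs k n"
  show "face (fourier (ttranspose X)) j = mat_adjoint (face (fourier X) j)"
    unfolding eq face_fourier_fourier_inv(1)[OF Z k n j]
    using j freqs_faced[OF X] k mat_adjoint_carrier[OF face_carrier[OF fourier_faced[OF X k] k]]
    by (intro face_tensor_of_faces) auto
qed

text \<open>
  The slices of a tensor are recovered from its Fourier slices by the inverse transform.
\<close>

lemma tensor_eqI_fourier_faces:
  assumes X: "X \<in> faced k n p q" and Y: "Y \<in> faced k n p q" and k: "k \<ge> 2"
    and n: "\<forall>t\<in>{3..k}. n t \<ge> 1"
    and faces: "\<And>j. j \<in> freqs k n \<Longrightarrow> face (fourier X) j = face (fourier Y) j"
  shows "X \<doteq> Y"
proof (rule tensor_eqI_faces[OF X Y k])
  note FX = fourier_faced[OF X k] and FY = fourier_faced[OF Y k]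
  fix j assume j: "j \<in> freqs k n"
  have "face (fourier_inv (fourier X)) j = face (fourier_inv (fourier Y)) j"
  proof (rule eq_matI)
    note cX = face_carrier[OF fourier_inv_faced[OF FX k n] k, of j]
    note cY = face_carrier[OF fourier_inv_faced[OF FY k n] k, of j]
    show "dim_row (face (fourier_inv (fourier X)) j) = dim_row (face (fourier_inv (fourier Y)) j)"
      "dim_col (face (fourier_inv (fourier X)) j) = dim_col (face (fourier_inv (fourier Y)) j)"
      using cX cY by auto
    fix a b assume "a < dim_row (face (fourier_inv (fourier Y)) j)"
      "b < dim_col (face (fourier_inv (fourier Y)) j)"
    with cY have ab: "a < p" "b < q" by auto
    show "face (fourier_inv (fourier X)) j $$ (a, b) = face (fourier_inv (fourier Y)) j $$ (a, b)"
      unfolding face_fourier_inv[OF FX k n j ab] face_fourier_inv[OF FY k n j ab]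
      by (intro sum.cong refl) (simp add: faces)
  qed
  then show "face X j = face Y j"
    unfolding face_fourier_fourier_inv(2)[OF X k n j] face_fourier_fourier_inv(2)[OF Y k n j] .
qed


section \<open>Dimension trees\<close>

lemma modes_nonempty: "modes T \<noteq> {}"
  by (induction T) auto

lemma modes_subtree: "t \<in> subtrees T \<Longrightarrow> modes t \<subseteq> modes T"
  by (induction T) auto

lemma subtree_refl: "T \<in> subtrees T"
  by (cases T) auto

lemma finite_subtrees: "finite (subtrees T)"
  by (induction T) auto

lemma finite_modes: "finite (modes T)"
  by (induction T) auto

lemma leaf_subtree: "t \<in> modes T \<Longrightarrow> DLeaf t \<in> subtrees T"
  by (induction T) auto

lemma leaf_tree_node: "t \<in> modes T \<Longrightarrow> {t} \<in> tree_nodes T"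
  unfolding tree_nodes_def by (drule leaf_subtree) force

lemma children_subtree:
  "DNode l r \<in> subtrees T \<Longrightarrow> l \<in> subtrees T \<and> r \<in> subtrees T"
  by (induction T) (auto simp: subtree_refl)

lemma dimension_tree_node:
  "dimension_tree D (DNode l r) \<longleftrightarrow>
     D = modes l \<union> modes r \<and> modes l \<inter> modes r = {} \<and>
     dimension_tree (modes l) l \<and> dimension_tree (modes r) r"
  unfolding dimension_tree_def subtrees.simps modes.simps by blast

lemma tree_nodes_node: "tree_nodes (DNode l r) = insert (modes l \<union> modes r) (tree_nodes l \<union> tree_nodes r)"
  by (auto simp: tree_nodes_def)

lemma tree_nodes_leaf: "tree_nodes (DLeaf t) = {{t}}"
  by (auto simp: tree_nodes_def)

lemma internal_nodes_node:
  "internal_nodes (DNode l r) =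
     insert (modes l \<union> modes r, modes l, modes r) (internal_nodes l \<union> internal_nodes r)"
  unfolding internal_nodes_def by auto

lemma internal_nodes_leaf: "internal_nodes (DLeaf t) = {}"
  by (simp add: internal_nodes_def)

lemma finite_internal_nodes: "finite (internal_nodes T)"
  by (induction T) (auto simp: internal_nodes_node internal_nodes_leaf)

text \<open>
  Subtrees of the two children have disjoint nonempty mode sets, and a proper subtree misses the modes
  of a sibling. Hence a quantity attached to a node, such as a transfer tensor, can be attributed to
  one subtree.
\<close>

lemma inj_on_modes_subtrees:
  assumes "dimension_tree D T"
  shows "inj_on modes (subtrees T)"
  using assms
proof (induction T arbitrary: D)
  case (DNode l r)
  then have disj: "modes l \<inter> modes r = {}"
    and il: "inj_on modes (subtrees l)" and ir: "inj_on modes (subtrees r)"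
    unfolding dimension_tree_node by blast+
  have "modes t \<noteq> modes t'" if "t \<in> subtrees l" "t' \<in> subtrees r" for t t'
    using modes_subtree[OF that(1)] modes_subtree[OF that(2)] disj modes_nonempty[of t] by blast
  moreover have "modes t \<noteq> modes l \<union> modes r" if "t \<in> subtrees l \<or> t \<in> subtrees r" for t
    using that modes_subtree[of t l] modes_subtree[of t r] disj modes_nonempty[of l] modes_nonempty[of r]
    by blast
  ultimately show ?case using il ir unfolding inj_on_def by (simp add: ball_Un) metis
qed simp


section \<open>Fourier faces of hierarchical Tucker tensors\<close>

text \<open>
  The rank indices at the leaves \<open>{1}\<close> and \<open>{2}\<close> are summed last. The two leaf factors at these modes
  are the only terms that involve the row indices \<open>a\<close> and \<open>b\<close>, and they come out of the inner sum.
\<close>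

lemma htd_entry_core:
  assumes T: "modes T = {1..k}" and k: "k \<ge> 2"
    and i: "i = j(1 := a, 2 := b)"
  shows "htd_entry T \<rho> L B i =
    (\<Sum>c<\<rho> {1}. \<Sum>d<\<rho> {2}. L 1 $$ (a, c) * htd_core T \<rho> L B j $$ (c, d) * L 2 $$ (b, d))"
proof -
  let ?N = "tree_nodes T - {{1}, {2}}"
  let ?W = "\<lambda>\<alpha>. \<Prod>(\<tau>, \<tau>1, \<tau>2)\<in>internal_nodes T. B \<tau> (\<alpha> \<tau>1) (\<alpha> \<tau>2) (\<alpha> \<tau>)"
  let ?f = "\<lambda>\<alpha>. ?W \<alpha> * (\<Prod>t\<in>modes T. L t $$ (i t, \<alpha> {t}))"
  have "{1} \<in> tree_nodes T" and "{2} \<in> tree_nodes T"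
    using k by (simp_all add: leaf_tree_node T)
  then have nodes: "tree_nodes T = insert {2} (insert {1} ?N)" by blast
  have "1 \<in> modes T" and "2 \<in> modes T" using k unfolding T by simp_all
  then have modes: "modes T = insert 1 (insert 2 (modes T - {1, 2}))" by blast
  have leaves: "(\<Prod>t\<in>modes T. L t $$ (i t, \<alpha> {t})) =
      L 1 $$ (a, \<alpha> {1}) * (L 2 $$ (b, \<alpha> {2}) * (\<Prod>t\<in>modes T - {1, 2}. L t $$ (j t, \<alpha> {t})))" for \<alpha>
  proof -
    have "(\<Prod>t\<in>modes T - {1, 2}. L t $$ (i t, \<alpha> {t})) = (\<Prod>t\<in>modes T - {1, 2}. L t $$ (j t, \<alpha> {t}))"
      by (intro prod.cong refl) (auto simp: i)
    then show ?thesis using finite_modes[of T]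
      by (subst modes) (simp add: i)
  qed
  have "htd_entry T \<rho> L B i = (\<Sum>d<\<rho> {2}. \<Sum>c<\<rho> {1}. \<Sum>\<alpha>\<in>(\<Pi>\<^sub>E \<tau>\<in>?N. {..<\<rho> \<tau>}). ?f (\<alpha>({1} := c, {2} := d)))"
    unfolding htd_entry_def
    by (subst nodes, subst sum_PiE_insert, simp, subst sum_PiE_insert, simp, rule refl)
  also have "\<dots> = (\<Sum>d<\<rho> {2}. \<Sum>c<\<rho> {1}. L 1 $$ (a, c) * htd_core T \<rho> L B j $$ (c, d) * L 2 $$ (b, d))"
  proof (intro sum.cong refl)
    fix c d assume "c \<in> {..<\<rho> {1}}" "d \<in> {..<\<rho> {2}}"
    then have core: "htd_core T \<rho> L B j $$ (c, d) = (\<Sum>\<alpha>\<in>(\<Pi>\<^sub>E \<tau>\<in>?N. {..<\<rho> \<tau>}).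
       ?W (\<alpha>({1} := c, {2} := d)) * (\<Prod>t\<in>modes T - {1, 2}. L t $$ (j t, (\<alpha>({1} := c, {2} := d)) {t})))"
      unfolding htd_core_def Let_def by simp
    show "(\<Sum>\<alpha>\<in>(\<Pi>\<^sub>E \<tau>\<in>?N. {..<\<rho> \<tau>}). ?f (\<alpha>({1} := c, {2} := d))) =
        L 1 $$ (a, c) * htd_core T \<rho> L B j $$ (c, d) * L 2 $$ (b, d)"
      unfolding core leaves sum_distrib_left sum_distrib_right
    proof (intro sum.cong refl)
      fix \<alpha> :: "nat set \<Rightarrow> nat"
      have "(\<alpha>({1} := c, {2} := d)) {1} = c" "(\<alpha>({1} := c, {2} := d)) {2} = d" by auto
      then show "?W (\<alpha>({1} := c, {2} := d)) *
          (L 1 $$ (a, (\<alpha>({1} := c, {2} := d)) {1}) * (L 2 $$ (b, (\<alpha>({1} := c, {2} := d)) {2}) *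
            (\<Prod>t\<in>modes T - {1, 2}. L t $$ (j t, (\<alpha>({1} := c, {2} := d)) {t})))) =
          L 1 $$ (a, c) * (?W (\<alpha>({1} := c, {2} := d)) *
            (\<Prod>t\<in>modes T - {1, 2}. L t $$ (j t, (\<alpha>({1} := c, {2} := d)) {t}))) * L 2 $$ (b, d)"
        by (simp only: mult_ac)
    qed
  qed
  also have "\<dots> = (\<Sum>c<\<rho> {1}. \<Sum>d<\<rho> {2}. L 1 $$ (a, c) * htd_core T \<rho> L B j $$ (c, d) * L 2 $$ (b, d))"
    by (rule sum.swap)
  finally show ?thesis .
qed

lemma htd_core_carrier: "htd_core T \<rho> L B j \<in> carrier_mat (\<rho> {1}) (\<rho> {2})"
  by (simp add: htd_core_def)

lemma htd_core_cong:
  assumes "\<And>t. t \<in> modes T - {1, 2} \<Longrightarrow> L t = L' t"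
  shows "htd_core T \<rho> L B j = htd_core T \<rho> L' B j"
  unfolding htd_core_def Let_def using assms by (auto intro!: cong_mat sum.cong prod.cong)

text \<open>
  The contraction is linear in the selected row of each leaf factor, and the row \<open>j\<^sub>t\<close> of \<open>A\<^sub>t L\<^sub>t\<close> is a
  combination of the rows of \<open>L\<^sub>t\<close> with coefficients from the row \<open>j\<^sub>t\<close> of \<open>A\<^sub>t\<close>.
\<close>

lemma htd_core_mult_leaves:
  assumes T: "modes T = {1..k}"
    and A: "\<And>t. t \<in> {3..k} \<Longrightarrow> A t \<in> carrier_mat (n t) (n t)"
    and L: "\<And>t. t \<in> {3..k} \<Longrightarrow> L t \<in> carrier_mat (n t) (\<rho> {t})"
    and j: "j \<in> freqs k n" and c: "c < \<rho> {1}" and d: "d < \<rho> {2}"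
  shows "htd_core T \<rho> (\<lambda>t. A t * L t) B j $$ (c, d) =
    (\<Sum>l\<in>freqs k n. (\<Prod>t\<in>{3..k}. A t $$ (j t, l t)) * htd_core T \<rho> L B l $$ (c, d))"
proof -
  let ?P = "\<Pi>\<^sub>E \<tau>\<in>tree_nodes T - {{1}, {2}}. {..<\<rho> \<tau>}"
  let ?\<beta> = "\<lambda>\<alpha>. \<alpha>({1} := c, {2} := d)"
  let ?W = "\<lambda>\<alpha>. \<Prod>(\<tau>, \<tau>1, \<tau>2)\<in>internal_nodes T. B \<tau> (?\<beta> \<alpha> \<tau>1) (?\<beta> \<alpha> \<tau>2) (?\<beta> \<alpha> \<tau>)"
  have modes: "modes T - {1, 2} = {3..k}"
    unfolding T by (rule Set.set_eqI) (simp, arith)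
  have core: "htd_core T \<rho> L' B l $$ (c, d) =
      (\<Sum>\<alpha>\<in>?P. ?W \<alpha> * (\<Prod>t\<in>{3..k}. L' t $$ (l t, ?\<beta> \<alpha> {t})))" for L' l
    unfolding htd_core_def Let_def modes using c d by simp
  have "htd_core T \<rho> (\<lambda>t. A t * L t) B j $$ (c, d) = (\<Sum>\<alpha>\<in>?P. ?W \<alpha> *
      (\<Sum>l\<in>freqs k n. (\<Prod>t\<in>{3..k}. A t $$ (j t, l t)) * (\<Prod>t\<in>{3..k}. L t $$ (l t, ?\<beta> \<alpha> {t}))))"
    unfolding core
  proof (intro sum.cong refl arg_cong2[where f = "(*)"])
    fix \<alpha> assume \<alpha>: "\<alpha> \<in> ?P"
    have "?\<beta> \<alpha> {t} < \<rho> {t}" if "t \<in> {3..k}" for t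
    proof -
      have "{t} \<in> tree_nodes T - {{1}, {2}}" using that leaf_tree_node[of t T] T by auto
      from PiE_mem[OF \<alpha> this] show ?thesis using that by auto
    qed
    then show "(\<Prod>t\<in>{3..k}. (A t * L t) $$ (j t, ?\<beta> \<alpha> {t})) =
      (\<Sum>l\<in>freqs k n. (\<Prod>t\<in>{3..k}. A t $$ (j t, l t)) * (\<Prod>t\<in>{3..k}. L t $$ (l t, ?\<beta> \<alpha> {t})))"
      by (intro prod_mult_mat_entry[OF A L j])
  qed
  also have "\<dots> = (\<Sum>l\<in>freqs k n. (\<Prod>t\<in>{3..k}. A t $$ (j t, l t)) *
      (\<Sum>\<alpha>\<in>?P. ?W \<alpha> * (\<Prod>t\<in>{3..k}. L t $$ (l t, ?\<beta> \<alpha> {t}))))"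
    unfolding sum_distrib_left
    by (rule trans[OF sum.swap]) (intro sum.cong refl mult.left_commute)
  finally show ?thesis unfolding core .
qed

lemma face_htd_tensor:
  assumes T: "modes T = {1..k}" and k: "k \<ge> 2"
    and L: "\<forall>t\<in>{1..k}. L t \<in> carrier_mat ((n(1 := p, 2 := q)) t) (\<rho> {t})"
  shows "htd_tensor k T \<rho> L B \<in> faced k n p q"
    and "face (htd_tensor k T \<rho> L B) j = L 1 * htd_core T \<rho> L B j * transpose_mat (L 2)"
proof -
  show F: "htd_tensor k T \<rho> L B \<in> faced k n p q"
    unfolding htd_tensor_def tensor_carrier_def using L by auto
  have L1: "L 1 \<in> carrier_mat p (\<rho> {1})" and L2: "L 2 \<in> carrier_mat q (\<rho> {2})"
    using bspec[OF L, of 1] bspec[OF L, of 2] k by auto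
  show "face (htd_tensor k T \<rho> L B) j = L 1 * htd_core T \<rho> L B j * transpose_mat (L 2)"
  proof (rule eq_matI)
    fix a b assume "a < dim_row (L 1 * htd_core T \<rho> L B j * transpose_mat (L 2))"
      "b < dim_col (L 1 * htd_core T \<rho> L B j * transpose_mat (L 2))"
    then have ab: "a < p" "b < q" using L1 L2 by auto
    show "face (htd_tensor k T \<rho> L B) j $$ (a, b) =
        (L 1 * htd_core T \<rho> L B j * transpose_mat (L 2)) $$ (a, b)"
      unfolding face_index[OF F k ab] triple_mult_entry[OF L1 htd_core_carrier L2 ab]
      by (simp add: htd_tensor_def htd_entry_core[OF T k])
  qed (use L1 L2 face_carrier[OF F k, of j] in auto)
qed

text \<open>
  The Fourier transform mixes slices at different frequencies, but the outer factors \<open>L\<^sub>1\<close> and \<open>L\<^sub>2\<close>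
  are common to all slices, and the mixture of the inner contractions is absorbed by the leaf factors.
\<close>

lemma face_fourier_htd_tensor:
  assumes T: "modes T = {1..k}" and k: "k \<ge> 2"
    and L: "\<forall>t\<in>{1..k}. L t \<in> carrier_mat ((n(1 := p, 2 := q)) t) (\<rho> {t})"
    and j: "j \<in> freqs k n"
  shows "face (fourier (htd_tensor k T \<rho> L B)) j =
    L 1 * htd_core T \<rho> (\<lambda>t. dft_mat (n t) * L t) B j * transpose_mat (L 2)"
proof (rule eq_matI)
  note F = face_htd_tensor(1)[OF T k L, of B] and face = face_htd_tensor(2)[OF T k L, of B]
  have L1: "L 1 \<in> carrier_mat p (\<rho> {1})" and L2: "L 2 \<in> carrier_mat q (\<rho> {2})"
    using bspec[OF L, of 1] bspec[OF L, of 2] k by auto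
  have Lt: "L t \<in> carrier_mat (n t) (\<rho> {t})" if "t \<in> {3..k}" for t
    using bspec[OF L, of t] that by auto
  let ?R = "L 1 * htd_core T \<rho> (\<lambda>t. dft_mat (n t) * L t) B j * transpose_mat (L 2)"
  show "dim_row (face (fourier (htd_tensor k T \<rho> L B)) j) = dim_row ?R"
    "dim_col (face (fourier (htd_tensor k T \<rho> L B)) j) = dim_col ?R"
    using L1 L2 face_carrier[OF fourier_faced[OF F k] k, of j] by auto
  fix a b assume "a < dim_row ?R" "b < dim_col ?R"
  then have ab: "a < p" "b < q" using L1 L2 by auto
  let ?K = "\<lambda>l. \<Prod>t\<in>{3..k}. dft_mat (n t) $$ (j t, l t)"
  have "face (fourier (htd_tensor k T \<rho> L B)) j $$ (a, b) =
    (\<Sum>l\<in>freqs k n. ?K l * (\<Sum>c<\<rho> {1}. \<Sum>d<\<rho> {2}. L 1 $$ (a, c) * htd_core T \<rho> L B l $$ (c, d) * L 2 $$ (b, d)))"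
    unfolding face_fourier[OF F k j ab] face triple_mult_entry[OF L1 htd_core_carrier L2 ab] ..
  also have "\<dots> = (\<Sum>c<\<rho> {1}. \<Sum>l\<in>freqs k n. \<Sum>d<\<rho> {2}.
      ?K l * (L 1 $$ (a, c) * htd_core T \<rho> L B l $$ (c, d) * L 2 $$ (b, d)))"
    unfolding sum_distrib_left by (rule sum.swap)
  also have "\<dots> = (\<Sum>c<\<rho> {1}. \<Sum>d<\<rho> {2}. L 1 $$ (a, c) *
      (\<Sum>l\<in>freqs k n. ?K l * htd_core T \<rho> L B l $$ (c, d)) * L 2 $$ (b, d))"
    unfolding sum_distrib_left sum_distrib_right
    by (intro sum.cong refl, rule trans[OF sum.swap], intro sum.cong refl)
      (simp only: mult.assoc mult.left_commute)
  also have "\<dots> = (\<Sum>c<\<rho> {1}. \<Sum>d<\<rho> {2}. L 1 $$ (a, c) *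
      htd_core T \<rho> (\<lambda>t. dft_mat (n t) * L t) B j $$ (c, d) * L 2 $$ (b, d))"
  proof (intro sum.cong refl arg_cong2[where f = "(*)"])
    fix c d assume "c \<in> {..<\<rho> {1}}" "d \<in> {..<\<rho> {2}}"
    then have cd: "c < \<rho> {1}" "d < \<rho> {2}" by auto
    show "(\<Sum>l\<in>freqs k n. ?K l * htd_core T \<rho> L B l $$ (c, d)) =
        htd_core T \<rho> (\<lambda>t. dft_mat (n t) * L t) B j $$ (c, d)"
      by (rule htd_core_mult_leaves[symmetric]) (use T dft_mat_carrier Lt j cd in auto)
  qed
  also have "\<dots> = ?R $$ (a, b)"
    unfolding triple_mult_entry[OF L1 htd_core_carrier L2 ab] ..
  finally show "face (fourier (htd_tensor k T \<rho> L B)) j $$ (a, b) = ?R $$ (a, b)" .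
qed


section \<open>Rank indices encoding frequency tuples\<close>

text \<open>
  \<open>freq_index\<close> is a mixed radix code with one digit \<open>j\<^sub>t < n\<^sub>t\<close> for each mode. The digits of the left
  subtree are the less significant ones.
\<close>

lemma freq_index_less:
  assumes "dimension_tree D T" and "\<forall>t\<in>D. j t < n t"
  shows "freq_index n T j < (\<Prod>t\<in>D. n t)"
  using assms
proof (induction T arbitrary: D)
  case (DLeaf t)
  then show ?case by (auto simp: dimension_tree_def)
next
  case (DNode l r)
  then have D: "D = modes l \<union> modes r" and disj: "modes l \<inter> modes r = {}"
    and L: "freq_index n l j < (\<Prod>t\<in>modes l. n t)" and R: "freq_index n r j < (\<Prod>t\<in>modes r. n t)"
    by (auto simp: dimension_tree_node)
  have "freq_index n (DNode l r) j < (\<Prod>t\<in>modes l. n t) * Suc (freq_index n r j)"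
    using L by simp
  also have "\<dots> \<le> (\<Prod>t\<in>modes l. n t) * (\<Prod>t\<in>modes r. n t)"
    using R by (intro mult_le_mono) auto
  also have "\<dots> = (\<Prod>t\<in>D. n t)"
    unfolding D by (rule prod.union_disjoint[OF finite_modes finite_modes disj, symmetric])
  finally show ?case .
qed

lemma mixed_radix_inj:
  fixes a b c d p :: nat
  assumes "a + p * b = c + p * d" and "a < p" and "c < p"
  shows "a = c \<and> b = d"
proof -
  have "(a + p * b) mod p = a" "(c + p * d) mod p = c" using assms(2,3) by simp_all
  with assms show ?thesis by auto
qed

lemma freq_index_inj:
  assumes "dimension_tree D T" and "\<forall>t\<in>D. j t < n t" and "\<forall>t\<in>D. j' t < n t"
    and "freq_index n T j = freq_index n T j'"
  shows "\<forall>t\<in>D. j t = j' t"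
  using assms
proof (induction T arbitrary: D)
  case (DLeaf t)
  then show ?case by (auto simp: dimension_tree_def)
next
  case (DNode l r)
  then have D: "D = modes l \<union> modes r"
    and l: "dimension_tree (modes l) l" and r: "dimension_tree (modes r) r"
    by (auto simp: dimension_tree_node)
  have lt: "\<forall>t\<in>modes l. j t < n t" "\<forall>t\<in>modes l. j' t < n t"
    and rt: "\<forall>t\<in>modes r. j t < n t" "\<forall>t\<in>modes r. j' t < n t"
    using DNode.prems(2,3) D by auto
  have "freq_index n l j = freq_index n l j' \<and> freq_index n r j = freq_index n r j'"
    using DNode.prems(4) freq_index_less[OF l lt(1)] freq_index_less[OF l lt(2)]
    by (intro mixed_radix_inj[where p = "\<Prod>t\<in>modes l. n t"]) auto
  with DNode.IH(1)[OF l lt] DNode.IH(2)[OF r rt] show ?case unfolding D by blast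
qed

lemma inj_on_freq_index:
  assumes "dimension_tree {3..k} Tf"
  shows "inj_on (freq_index n Tf) (freqs k n)"
proof (rule inj_onI)
  fix j j' assume j: "j \<in> freqs k n" and j': "j' \<in> freqs k n"
    and "freq_index n Tf j = freq_index n Tf j'"
  with freq_index_inj[OF assms, of j n j'] freqs_less[OF j] freqs_less[OF j']
  have "\<forall>t\<in>{3..k}. j t = j' t" by blast
  then show "j = j'" using j j' unfolding freqs_def by (intro PiE_ext) auto
qed

lemma inj_on_pair_index: "inj_on (pair_index p) ({..<p} \<times> {..<q})"
proof (rule inj_onI)
  fix x y assume "x \<in> {..<p} \<times> {..<q}" "y \<in> {..<p} \<times> {..<q}" "pair_index p x = pair_index p y"
  then show "x = y"
    using mixed_radix_inj[of "fst x" p "snd x" "fst y" "snd y"]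
    by (auto simp: pair_index_def case_prod_unfold mult.commute prod_eq_iff)
qed

lemma pair_index_less: "a < p \<Longrightarrow> b < q \<Longrightarrow> pair_index p (a, b) < p * (q :: nat)"
proof -
  assume "a < p" "b < q"
  then have "pair_index p (a, b) < p * Suc b" by (simp add: pair_index_def mult.commute)
  also have "\<dots> \<le> p * q" using \<open>b < q\<close> by (intro mult_le_mono) auto
  finally show ?thesis .
qed


section \<open>Contraction of the factor networks\<close>

text \<open>
  The tree shared by the given tensor and by the three factors.
\<close>

locale hosvd_tree =
  fixes k :: nat and n :: "nat \<Rightarrow> nat" and T Tf :: dtree
  assumes k: "k \<ge> 3" and T: "T = DNode (DNode (DLeaf 1) (DLeaf 2)) Tf"
    and dim_tree: "dimension_tree {1..k} T"
begin

lemma tail_tree: "dimension_tree {3..k} Tf"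
proof -
  have D: "{1..k} = {1, 2} \<union> modes Tf" and disj: "{1, 2} \<inter> modes Tf = {}"
    and Tf: "dimension_tree (modes Tf) Tf"
    using dim_tree unfolding T dimension_tree_node by auto
  have "modes Tf = {1..k} - {1, 2}" using D disj by blast
  also have "\<dots> = {3..k}" by (rule Set.set_eqI) (simp, arith)
  finally show ?thesis using Tf by simp
qed

lemma modes_tail: "modes Tf = {3..k}"
  using tail_tree by (simp add: dimension_tree_def)

lemma modes_tree: "modes T = {1..k}"
  using dim_tree by (simp add: dimension_tree_def)

text \<open>
  The ranks and transfer tensors of the factors distinguish the cases \<open>{1}\<close>, \<open>{2}\<close>, \<open>{1, 2}\<close>, the root
  and all other nodes. The cases do not overlap, and the nodes of the tail fall into the last one.
\<close>

lemma special_nodes: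
  "{1..k} \<noteq> {1}" "{1..k} \<noteq> {2}" "{1..k} \<noteq> {1, 2}"
  "\<tau> \<subseteq> {3..k} \<Longrightarrow> \<tau> \<noteq> {} \<Longrightarrow> \<tau> \<noteq> {1} \<and> \<tau> \<noteq> {2} \<and> \<tau> \<noteq> {1, 2} \<and> \<tau> \<noteq> {1..k}"
proof -
  have mem: "3 \<in> {1..k}" "1 \<in> {1..k}" using k by auto
  have not: "3 \<notin> {1::nat}" "3 \<notin> {2::nat}" "3 \<notin> {1, 2::nat}" by simp_all
  show "{1..k} \<noteq> {1}" "{1..k} \<noteq> {2}" "{1..k} \<noteq> {1, 2}"
    using mem not by metis+
  assume "\<tau> \<subseteq> {3..k}" "\<tau> \<noteq> {}"
  then have "1 \<notin> \<tau>" "2 \<notin> \<tau>" by auto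
  then show "\<tau> \<noteq> {1} \<and> \<tau> \<noteq> {2} \<and> \<tau> \<noteq> {1, 2} \<and> \<tau> \<noteq> {1..k}" using mem by blast
qed

lemma subtree_special:
  assumes "t \<in> subtrees Tf"
  shows "modes t \<noteq> {1} \<and> modes t \<noteq> {2} \<and> modes t \<noteq> {1, 2} \<and> modes t \<noteq> {1..k}"
  using special_nodes(4)[OF _ modes_nonempty] modes_subtree[OF assms] modes_tail by simp

lemma subtree_dimension_tree:
  assumes "t \<in> subtrees Tf"
  shows "dimension_tree (modes t) t"
proof -
  have "subtrees t \<subseteq> subtrees Tf" using assms by (induction Tf) auto
  then show ?thesis using tail_tree unfolding dimension_tree_def by blast
qed

lemma inner_tree_nodes:
  "tree_nodes T - {{1}, {2}} = insert {1..k} (insert {1, 2} (modes ` subtrees Tf))"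
proof -
  have "tree_nodes T = insert {1..k} (insert {1, 2} (insert {1} (insert {2} (modes ` subtrees Tf))))"
    using modes_tree unfolding T tree_nodes_node tree_nodes_leaf by (auto simp: tree_nodes_def)
  moreover have "{1} \<notin> modes ` subtrees Tf" "{2} \<notin> modes ` subtrees Tf"
    using subtree_special by blast+
  moreover have "{1, 2} \<noteq> {1::nat}" "{1, 2} \<noteq> {2::nat}" by auto
  moreover have "insert K (insert P (insert a (insert b S))) - {a, b} = insert K (insert P S)"
    if "a \<notin> S" "b \<notin> S" "P \<noteq> a" "P \<noteq> b" "K \<noteq> a" "K \<noteq> b"
    for K P a b :: "nat set" and S
    using that by blast
  ultimately show ?thesis using special_nodes(1,2) by simp
qed

lemma internal_nodes_tree:
  "internal_nodes T =
     insert ({1..k}, {1, 2}, {3..k}) (insert ({1, 2}, {1}, {2}) (internal_nodes Tf))"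
proof -
  have "modes T = {1, 2} \<union> modes Tf" unfolding T modes.simps by blast
  then have "{1, 2} \<union> modes Tf = {1..k}" "{1} \<union> {2} = {1, 2::nat}" using modes_tree by auto
  then show ?thesis
    unfolding T internal_nodes_node internal_nodes_leaf modes.simps modes_tail by simp
qed

lemma prod_internal_nodes:
  "(\<Prod>x\<in>internal_nodes T. f x) =
     f ({1..k}, {1, 2}, {3..k}) * (f ({1, 2}, {1}, {2}) * (\<Prod>x\<in>internal_nodes Tf. f x))"
proof -
  have "\<tau> \<in> modes ` subtrees Tf" if "(\<tau>, \<tau>1, \<tau>2) \<in> internal_nodes Tf" for \<tau> \<tau>1 \<tau>2
    using that unfolding internal_nodes_def by blast
  moreover have "{1, 2} \<notin> modes ` subtrees Tf" "{1..k} \<notin> modes ` subtrees Tf"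
    using subtree_special by blast+
  ultimately have "({1, 2}, {1}, {2}) \<notin> internal_nodes Tf"
      "({1..k}, {1, 2}, {3..k}) \<notin> internal_nodes Tf"
    by metis+
  then show ?thesis unfolding internal_nodes_tree using special_nodes(3) finite_internal_nodes[of Tf] by simp
qed

text \<open>
  The one assignment of rank indices that contributes to the contraction of a factor network for given
  frequencies \<open>j\<close> and given indices \<open>a\<close>, \<open>b\<close> at the two open leaves. It is a function on nodes, so the
  code at a node of the tail refers to the unique subtree with these modes.
\<close>

definition path_index :: "nat \<Rightarrow> nat \<Rightarrow> nat \<Rightarrow> (nat \<Rightarrow> nat) \<Rightarrow> nat set \<Rightarrow> nat" where
  "path_index p a b j = (\<lambda>\<tau>\<in>tree_nodes T - {{1}, {2}}.
     if \<tau> = {1, 2} then pair_index p (a, b)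
     else if \<tau> = {1..k} then 0
     else freq_index n (the_inv_into (subtrees Tf) modes \<tau>) j)"

lemma path_index_simps:
  "path_index p a b j {1, 2} = pair_index p (a, b)"
  "path_index p a b j {1..k} = 0"
  "t \<in> subtrees Tf \<Longrightarrow> path_index p a b j (modes t) = freq_index n t j"
  using special_nodes(3) subtree_special[of t] the_inv_into_f_f[OF inj_on_modes_subtrees[OF tail_tree], of t]
  unfolding path_index_def inner_tree_nodes by auto

lemma transfer_pair:
  "a < p \<Longrightarrow> b < q \<Longrightarrow> hosvd_transfer k n Tf p q M {1, 2} a b z = (if z = pair_index p (a, b) then 1 else 0)"
  by (simp add: hosvd_transfer_def)

text \<open>
  Both index maps are injective, so the stored matrix and its entry are found again from the ranks.
\<close>

lemma transfer_root:
  assumes ab: "a < p" "b < q" and j: "j \<in> freqs k n"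
  shows "hosvd_transfer k n Tf p q M {1..k} (pair_index p (a, b)) (freq_index n Tf j) z =
    (if z = 0 then M j $$ (a, b) else 0)"
proof -
  have "the_inv_into (freqs k n) (freq_index n Tf) (freq_index n Tf j) = j"
    by (rule the_inv_into_f_f[OF inj_on_freq_index[OF tail_tree] j])
  moreover have "the_inv_into ({..<p} \<times> {..<q}) (pair_index p) (pair_index p (a, b)) = (a, b)"
    by (rule the_inv_into_f_f[OF inj_on_pair_index]) (use ab in simp)
  ultimately show ?thesis using ab j special_nodes(3) by (simp add: hosvd_transfer_def)
qed

text \<open>
  The definition asks for some subtree with the modes of the given node. There is only one.
\<close>

lemma transfer_subtree:
  assumes "DNode l r \<in> subtrees Tf"
  shows "hosvd_transfer k n Tf p q M (modes (DNode l r)) x y z =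
    (if \<exists>j\<in>freqs k n. x = freq_index n l j \<and> y = freq_index n r j \<and> z = freq_index n (DNode l r) j
     then 1 else 0)"
proof -
  have "DNode l' r' = DNode l r"
    if "DNode l' r' \<in> subtrees Tf" "modes (DNode l' r') = modes (DNode l r)" for l' r'
    using inj_onD[OF inj_on_modes_subtrees[OF tail_tree] that(2) that(1) assms] .
  then have "(\<exists>l' r'. DNode l' r' \<in> subtrees Tf \<and> modes (DNode l' r') = modes (DNode l r) \<and> Q l' r') = Q l r" for Q
    using assms by blast
  then show ?thesis using subtree_special[OF assms] unfolding hosvd_transfer_def Let_def by simp
qed

lemma path_index_in:
  assumes ab: "a < p" "b < q" and j: "j \<in> freqs k n"
  shows "path_index p a b j \<in> (\<Pi>\<^sub>E \<tau>\<in>tree_nodes T - {{1}, {2}}. {..<hosvd_rank k n p q \<tau>})"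
proof (rule PiE_I)
  fix \<tau> assume "\<tau> \<in> tree_nodes T - {{1}, {2}}"
  then consider "\<tau> = {1..k}" | "\<tau> = {1, 2}" | t where "t \<in> subtrees Tf" "\<tau> = modes t"
    unfolding inner_tree_nodes by blast
  then show "path_index p a b j \<tau> \<in> {..<hosvd_rank k n p q \<tau>}"
  proof cases
    case 1
    show ?thesis using special_nodes(1-3) unfolding 1 path_index_simps(2) hosvd_rank_def by simp
  next
    case 2
    have "{1, 2} \<noteq> {1::nat}" "{1, 2} \<noteq> {2::nat}" by auto
    then show ?thesis using pair_index_less[OF ab] unfolding 2 path_index_simps(1) hosvd_rank_def by simp
  next
    case 3
    have "\<forall>m\<in>modes t. j m < n m"
      using freqs_less[OF j] modes_subtree[OF 3(1)] modes_tail by blast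
    from freq_index_less[OF subtree_dimension_tree[OF 3(1)] this]
    show ?thesis using subtree_special[OF 3(1)] unfolding 3(2) path_index_simps(3)[OF 3(1)] hosvd_rank_def by simp
  qed
qed (unfold path_index_def restrict_def, rule if_not_P)

text \<open>
  An assignment of rank indices with nonzero weight agrees with \<open>j\<close> at the leaves of the tail, because
  the identity matrices vanish off the diagonal. By induction on the subtree it carries the code of \<open>j\<close>
  at every node of the tail, because the transfer tensor at a node is supported on triples in which the
  third index is the combined code of the other two. At \<open>{1, 2}\<close> and at the root its values are forced
  too, so only \<open>path_index\<close> remains. Its weight is 1 at all nodes except the root, which supplies the
  entry of \<open>M j\<close>.
\<close>

lemma htd_core_hosvd:
  assumes j: "j \<in> freqs k n" and M: "M j \<in> carrier_mat p q"
    and L: "\<And>t. t \<in> {3..k} \<Longrightarrow> L t = 1\<^sub>m (n t)"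
  shows "htd_core T (hosvd_rank k n p q) L (hosvd_transfer k n Tf p q M) j = M j"
proof (rule eq_matI)
  let ?\<rho> = "hosvd_rank k n p q" and ?B = "hosvd_transfer k n Tf p q M"
  have \<rho>: "?\<rho> {1} = p" "?\<rho> {2} = q" by (simp_all add: hosvd_rank_def)
  show "dim_row (htd_core T ?\<rho> L ?B j) = dim_row (M j)" "dim_col (htd_core T ?\<rho> L ?B j) = dim_col (M j)"
    using M \<rho> by (simp_all add: htd_core_def)
  fix a b assume "a < dim_row (M j)" "b < dim_col (M j)"
  then have ab: "a < p" "b < q" using M by auto
  let ?P = "\<Pi>\<^sub>E \<tau>\<in>tree_nodes T - {{1}, {2}}. {..<?\<rho> \<tau>}"
  let ?\<beta> = "\<lambda>\<alpha>. \<alpha>({1} := a, {2} := b)"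
  let ?W = "\<lambda>\<alpha>. \<Prod>(\<tau>, \<tau>1, \<tau>2)\<in>internal_nodes T. ?B \<tau> (?\<beta> \<alpha> \<tau>1) (?\<beta> \<alpha> \<tau>2) (?\<beta> \<alpha> \<tau>)"
  let ?V = "\<lambda>\<alpha>. \<Prod>t\<in>{3..k}. L t $$ (j t, ?\<beta> \<alpha> {t})"
  let ?\<gamma> = "path_index p a b j"
  have tail: "modes T - {1, 2} = {3..k}"
    unfolding modes_tree by (rule Set.set_eqI) (simp, arith)
  have core: "htd_core T ?\<rho> L ?B j $$ (a, b) = (\<Sum>\<alpha>\<in>?P. ?W \<alpha> * ?V \<alpha>)"
    unfolding htd_core_def Let_def tail using ab \<rho> by simp
  have other: "?\<beta> \<alpha> (modes t) = \<alpha> (modes t)" if "t \<in> subtrees Tf" for \<alpha> t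
    using subtree_special[OF that] by simp
  have special: "?\<beta> \<alpha> {1} = a" "?\<beta> \<alpha> {2} = b" "?\<beta> \<alpha> {1, 2} = \<alpha> {1, 2}" "?\<beta> \<alpha> {1..k} = \<alpha> {1..k}"
    "?\<beta> \<alpha> {3..k} = \<alpha> {3..k}" for \<alpha>
    using special_nodes(1,2) other[OF subtree_refl, unfolded modes_tail]
    by (auto simp: doubleton_eq_iff)
  \<comment> \<open>The indices at the two open leaves enter only the transfer tensor at \<open>{1, 2}\<close>.\<close>
  have W: "?W \<alpha> = ?B {1..k} (\<alpha> {1, 2}) (\<alpha> {3..k}) (\<alpha> {1..k}) * (?B {1, 2} a b (\<alpha> {1, 2}) *
      (\<Prod>(\<tau>, \<tau>1, \<tau>2)\<in>internal_nodes Tf. ?B \<tau> (\<alpha> \<tau>1) (\<alpha> \<tau>2) (\<alpha> \<tau>)))" for \<alpha>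
  proof -
    have "(\<Prod>(\<tau>, \<tau>1, \<tau>2)\<in>internal_nodes Tf. ?B \<tau> (?\<beta> \<alpha> \<tau>1) (?\<beta> \<alpha> \<tau>2) (?\<beta> \<alpha> \<tau>)) =
        (\<Prod>(\<tau>, \<tau>1, \<tau>2)\<in>internal_nodes Tf. ?B \<tau> (\<alpha> \<tau>1) (\<alpha> \<tau>2) (\<alpha> \<tau>))"
    proof (intro prod.cong refl)
      fix x assume "x \<in> internal_nodes Tf"
      then obtain l r where lr: "DNode l r \<in> subtrees Tf" and x: "x = (modes (DNode l r), modes l, modes r)"
        unfolding internal_nodes_def by blast
      note ch = children_subtree[OF lr]
      show "(case x of (\<tau>, \<tau>1, \<tau>2) \<Rightarrow> ?B \<tau> (?\<beta> \<alpha> \<tau>1) (?\<beta> \<alpha> \<tau>2) (?\<beta> \<alpha> \<tau>)) =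
        (case x of (\<tau>, \<tau>1, \<tau>2) \<Rightarrow> ?B \<tau> (\<alpha> \<tau>1) (\<alpha> \<tau>2) (\<alpha> \<tau>))"
        unfolding x prod.case other[OF lr] other[OF conjunct1[OF ch]] other[OF conjunct2[OF ch]] ..
    qed
    then show ?thesis unfolding prod_internal_nodes prod.case special by simp
  qed
  have V: "?V \<alpha> = (\<Prod>t\<in>{3..k}. (1\<^sub>m (n t)) $$ (j t, \<alpha> {t}))" for \<alpha>
  proof (intro prod.cong refl)
    fix t assume t: "t \<in> {3..k}"
    then have "DLeaf t \<in> subtrees Tf" by (simp add: leaf_subtree modes_tail)
    from other[OF this] L[OF t] show "L t $$ (j t, ?\<beta> \<alpha> {t}) = (1\<^sub>m (n t)) $$ (j t, \<alpha> {t})" by simp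
  qed
  have zero: "?W \<alpha> * ?V \<alpha> = 0" if \<alpha>: "\<alpha> \<in> ?P - {?\<gamma>}" for \<alpha>
  proof (rule ccontr)
    assume "?W \<alpha> * ?V \<alpha> \<noteq> 0"
    then have nz: "?B {1..k} (\<alpha> {1, 2}) (\<alpha> {3..k}) (\<alpha> {1..k}) \<noteq> 0" "?B {1, 2} a b (\<alpha> {1, 2}) \<noteq> 0"
      and nzB: "(\<Prod>(\<tau>, \<tau>1, \<tau>2)\<in>internal_nodes Tf. ?B \<tau> (\<alpha> \<tau>1) (\<alpha> \<tau>2) (\<alpha> \<tau>)) \<noteq> 0"
      and nzL: "(\<Prod>t\<in>{3..k}. (1\<^sub>m (n t) :: complex mat) $$ (j t, \<alpha> {t})) \<noteq> 0"
      unfolding W V by auto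
    \<comment> \<open>Nonzero factors force the codes of \<open>j\<close>, from the leaves upwards.\<close>
    have sub: "\<alpha> (modes t) = freq_index n t j" if "t \<in> subtrees Tf" for t
      using that
    proof (induction t)
      case (DLeaf m)
      then have m: "m \<in> {3..k}" using modes_subtree[OF DLeaf] modes_tail by simp
      with nzL have nz1: "(1\<^sub>m (n m) :: complex mat) $$ (j m, \<alpha> {m}) \<noteq> 0" by simp
      have "{m} \<in> tree_nodes T - {{1}, {2}}"
        unfolding inner_tree_nodes using DLeaf by force
      with \<alpha> have "\<alpha> {m} < ?\<rho> {m}" by (auto dest: PiE_mem)
      moreover have "?\<rho> {m} = n m" using subtree_special[OF DLeaf] by (simp add: hosvd_rank_def)
      ultimately have "\<alpha> {m} < n m" by simp
      with nz1 freqs_less[OF j m] show ?case by (simp split: if_splits)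
    next
      case (DNode l r)
      note ch = children_subtree[OF DNode.prems]
      have "(modes (DNode l r), modes l, modes r) \<in> internal_nodes Tf"
        using DNode.prems unfolding internal_nodes_def by blast
      with nzB finite_internal_nodes have
        "?B (modes (DNode l r)) (\<alpha> (modes l)) (\<alpha> (modes r)) (\<alpha> (modes (DNode l r))) \<noteq> 0"
        by (fastforce simp del: modes.simps)
      \<comment> \<open>The witnessing frequencies need not be \<open>j\<close> a priori, but
        their codes satisfy the same recursion.\<close>
      then have "\<alpha> (modes (DNode l r)) = \<alpha> (modes l) + (\<Prod>t\<in>modes l. n t) * \<alpha> (modes r)"
        unfolding transfer_subtree[OF DNode.prems] by (auto split: if_splits)
      with DNode.IH ch show ?case by simp
    qed
    have pair: "\<alpha> {1, 2} = pair_index p (a, b)"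
      using nz(2) unfolding transfer_pair[OF ab] by (simp split: if_splits)
    have root0: "\<alpha> {1..k} = 0"
      using nz(1) special_nodes(3) unfolding hosvd_transfer_def Let_def by (simp split: if_splits)
    have "\<alpha> \<tau> = ?\<gamma> \<tau>" if "\<tau> \<in> tree_nodes T - {{1}, {2}}" for \<tau>
    proof -
      from that consider "\<tau> = {1..k}" | "\<tau> = {1, 2}" | t where "t \<in> subtrees Tf" "\<tau> = modes t"
        unfolding inner_tree_nodes by blast
      then show ?thesis
        using root0 pair sub by cases (simp_all only: path_index_simps)
    qed
    with \<alpha> path_index_in[OF ab j] have "\<alpha> = ?\<gamma>" by (intro PiE_ext) auto
    with \<alpha> show False by simp
  qed
  have root: "?\<gamma> {3..k} = freq_index n Tf j"
    using path_index_simps(3)[OF subtree_refl] unfolding modes_tail .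
  have "(\<Prod>(\<tau>, \<tau>1, \<tau>2)\<in>internal_nodes Tf. ?B \<tau> (?\<gamma> \<tau>1) (?\<gamma> \<tau>2) (?\<gamma> \<tau>)) = 1"
  proof (intro prod.neutral ballI)
    fix x assume "x \<in> internal_nodes Tf"
    then obtain l r where lr: "DNode l r \<in> subtrees Tf" and x: "x = (modes (DNode l r), modes l, modes r)"
      unfolding internal_nodes_def by blast
    note ch = children_subtree[OF lr]
    show "(case x of (\<tau>, \<tau>1, \<tau>2) \<Rightarrow> ?B \<tau> (?\<gamma> \<tau>1) (?\<gamma> \<tau>2) (?\<gamma> \<tau>)) = 1"
      unfolding x prod.case path_index_simps(3)[OF lr] path_index_simps(3)[OF conjunct1[OF ch]]
        path_index_simps(3)[OF conjunct2[OF ch]] transfer_subtree[OF lr] using j by auto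
  qed
  then have W\<gamma>: "?W ?\<gamma> = M j $$ (a, b)"
    unfolding W path_index_simps(1,2) root transfer_pair[OF ab] transfer_root[OF ab j] by simp
  have "?V ?\<gamma> = 1"
    unfolding V
  proof (intro prod.neutral ballI)
    fix t assume t: "t \<in> {3..k}"
    then have "DLeaf t \<in> subtrees Tf" by (simp add: leaf_subtree modes_tail)
    from path_index_simps(3)[OF this] have "?\<gamma> {t} = j t" by simp
    with freqs_less[OF j t] show "(1\<^sub>m (n t) :: complex mat) $$ (j t, ?\<gamma> {t}) = 1" by simp
  qed
  have fin: "finite ?P"
    unfolding inner_tree_nodes by (intro finite_PiE) (simp_all add: finite_subtrees)
  have "htd_core T ?\<rho> L ?B j $$ (a, b) = (\<Sum>\<alpha>\<in>{?\<gamma>}. ?W \<alpha> * ?V \<alpha>)"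
    unfolding core by (rule sum.mono_neutral_right[OF fin]) (use path_index_in[OF ab j] zero in auto)
  also have "\<dots> = M j $$ (a, b)"
    using W\<gamma> \<open>?V ?\<gamma> = 1\<close> by (simp only: sum.insert finite.emptyI empty_iff not_False_eq_True sum.empty mult_1_right add_0_right)
  finally show "htd_core T ?\<rho> L ?B j $$ (a, b) = M j $$ (a, b)" .
qed

text \<open>
  The inverse Fourier matrices at the leaves of the tail cancel against the transform, so the Fourier
  slices display the stored matrices between the two outer leaf factors.
\<close>

lemma hosvd_tensor:
  fixes L1 L2 :: "complex mat" and M :: "(nat \<Rightarrow> nat) \<Rightarrow> complex mat"
  assumes L1: "L1 \<in> carrier_mat u p" and L2: "L2 \<in> carrier_mat v q"
    and n: "\<forall>t\<in>{3..k}. n t \<ge> 1"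
  defines "X \<equiv> htd_tensor k T (hosvd_rank k n p q) (hosvd_leaf n L1 L2) (hosvd_transfer k n Tf p q M)"
  shows "X \<in> faced k n u v"
    and "htd_format X T (hosvd_rank k n p q) (hosvd_leaf n L1 L2) (hosvd_transfer k n Tf p q M)"
    and "\<lbrakk>j \<in> freqs k n; M j \<in> carrier_mat p q\<rbrakk> \<Longrightarrow>
      face (fourier X) j = L1 * M j * transpose_mat L2"
proof -
  let ?\<rho> = "hosvd_rank k n p q" and ?L = "hosvd_leaf n L1 L2"
  have k2: "k \<ge> 2" using k by simp
  have L: "\<forall>t\<in>{1..k}. ?L t \<in> carrier_mat ((n(1 := u, 2 := v)) t) (?\<rho> {t})"
  proof
    fix t assume "t \<in> {1..k}"
    then consider "t = 1" | "t = 2" | "t \<in> {3..k}" by force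
    then show "?L t \<in> carrier_mat ((n(1 := u, 2 := v)) t) (?\<rho> {t})"
    proof cases
      case 3
      then have "?\<rho> {t} = n t" using special_nodes(4)[of "{t}"] by (simp add: hosvd_rank_def)
      then show ?thesis using 3 dft_inv_mat_inverse(1) n by (simp add: hosvd_leaf_def)
    qed (use L1 L2 in \<open>simp_all add: hosvd_leaf_def hosvd_rank_def\<close>)
  qed
  show X: "X \<in> faced k n u v"
    unfolding X_def by (rule face_htd_tensor(1)[OF modes_tree k2 L])
  have "\<forall>t\<in>{1..k}. ?L t \<in> carrier_mat (tsize X t) (?\<rho> {t})"
    using L X unfolding tensor_carrier_def by auto
  moreover have "?\<rho> {1..k} = 1"
    unfolding hosvd_rank_def using special_nodes(1-3) by simp
  ultimately show "htd_format X T ?\<rho> ?L (hosvd_transfer k n Tf p q M)"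
    unfolding htd_format_def facedD(1)[OF X k2] using dim_tree by (simp add: X_def htd_tensor_def)
  assume j: "j \<in> freqs k n" and M: "M j \<in> carrier_mat p q"
  have "htd_core T ?\<rho> (\<lambda>t. dft_mat (n t) * ?L t) (hosvd_transfer k n Tf p q M) j = M j"
    using n dft_inv_mat_inverse(2) by (intro htd_core_hosvd j M) (simp add: hosvd_leaf_def)
  then show "face (fourier X) j = L1 * M j * transpose_mat L2"
    unfolding X_def face_fourier_htd_tensor[OF modes_tree k2 L j] by (simp add: hosvd_leaf_def)
qed

end


section \<open>The higher-order singular value decomposition\<close>

theorem proposition4p6:
  fixes k s :: nat
    and n :: "nat \<Rightarrow> nat"
    and T :: "real tensor"
    and \<T> \<T>f :: dtree
    and r :: "nat set \<Rightarrow> nat"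
    and U :: "nat \<Rightarrow> real mat"
    and B :: "complex transfer"
    and U_tilde :: "nat \<Rightarrow> complex mat"
    and G Uj Vj :: "(nat \<Rightarrow> nat) \<Rightarrow> complex mat"
    and Sj :: "(nat \<Rightarrow> nat) \<Rightarrow> real mat"
    and \<U> \<S> \<V> :: "complex tensor"
    and \<rho>U \<rho>S \<rho>V :: "nat set \<Rightarrow> nat"
    and LU LS LV :: "nat \<Rightarrow> complex mat"
    and BU BS BV :: "complex transfer"
  assumes k: "k \<ge> 3"
    and n_pos: "\<And>t. t \<in> {1..k} \<Longrightarrow> n t \<ge> 1"
    and T_size: "T \<in> tensor_carrier k n"
    and \<T>: "\<T> = DNode (DNode (DLeaf 1) (DLeaf 2)) \<T>f"
    and T_htd: "htd_format (map_tensor complex_of_real T) \<T> r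
                  (\<lambda>t. map_mat complex_of_real (U t)) B"
    and U1: "orthonormal_cols (U 1)"
    and U2: "orthonormal_cols (U 2)"
    and U_tilde: "\<And>t. t \<in> {3..k} \<Longrightarrow>
                    U_tilde t = dft_mat (n t) * map_mat complex_of_real (U t)"
    and G: "\<And>j. j \<in> freqs k n \<Longrightarrow> G j = htd_core \<T> r U_tilde B j"
    and s: "s = Max ((\<lambda>j. vec_space.rank (r {1}) (G j)) ` freqs k n)"
    and svd: "\<And>j. j \<in> freqs k n \<Longrightarrow> padded_svd s (G j) (Uj j) (Sj j) (Vj j)"
    and \<rho>U: "\<rho>U = hosvd_rank k n (r {1}) s"
    and \<rho>S: "\<rho>S = hosvd_rank k n s s"
    and \<rho>V: "\<rho>V = hosvd_rank k n (r {2}) s"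
    and LU: "LU = hosvd_leaf n (map_mat complex_of_real (U 1)) (1\<^sub>m s)"
    and LS: "LS = hosvd_leaf n (1\<^sub>m s) (1\<^sub>m s)"
    and LV: "LV = hosvd_leaf n (map_mat complex_of_real (U 2)) (1\<^sub>m s)"
    and BU: "BU = hosvd_transfer k n \<T>f (r {1}) s Uj"
    and BS: "BS = hosvd_transfer k n \<T>f s s (\<lambda>j. map_mat complex_of_real (Sj j))"
    and BV: "BV = hosvd_transfer k n \<T>f (r {2}) s Vj"
    and \<U>: "\<U> = htd_tensor k \<T> \<rho>U LU BU"
    and \<S>: "\<S> = htd_tensor k \<T> \<rho>S LS BS"
    and \<V>: "\<V> = htd_tensor k \<T> \<rho>V LV BV"
  shows "\<U> \<in> tensor_carrier k (n(2 := s)) \<and> htd_format \<U> \<T> \<rho>U LU BU \<and>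
         \<S> \<in> tensor_carrier k (n(1 := s, 2 := s)) \<and> htd_format \<S> \<T> \<rho>S LS BS \<and>
         \<V> \<in> tensor_carrier k (n(1 := n 2, 2 := s)) \<and> htd_format \<V> \<T> \<rho>V LV BV \<and>
         map_tensor complex_of_real T \<doteq> \<U> \<star>\<^sub>H \<S> \<star>\<^sub>H ttranspose \<V> \<and>
         (\<forall>j\<in>freqs k n.
            orthonormal_cols (face (fourier \<U>) j) \<and>
            orthonormal_cols (face (fourier \<V>) j) \<and>
            diagonal_mat (face (fourier \<S>) j) \<and>
            (\<forall>i<s. \<exists>\<sigma>\<ge>0. face (fourier \<S>) j $$ (i, i) = complex_of_real \<sigma>))"
proof -
  let ?c = "map_mat complex_of_real"
  let ?T = "map_tensor complex_of_real T"
  have T_ord: "torder ?T = k" and T_ts: "\<forall>t\<in>{1..k}. tsize ?T t = n t"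
    using T_size by (simp_all add: tensor_carrier_def tensor.map_sel)
  have tree: "dimension_tree {1..k} \<T>"
    and U_dim: "\<forall>t\<in>{1..k}. ?c (U t) \<in> carrier_mat ((n(1 := n 1, 2 := n 2)) t) (r {t})"
    and T_entry: "\<forall>i\<in>tindex ?T. tentry ?T i = htd_entry \<T> r (\<lambda>t. ?c (U t)) B i"
    using T_htd T_ts unfolding htd_format_def T_ord by simp_all
  interpret hosvd_tree k n \<T> \<T>f
    using k \<T> tree by unfold_locales
  have k2: "k \<ge> 2" using k by simp
  have n: "\<forall>t\<in>{3..k}. n t \<ge> 1" using n_pos by simp
  have U1_dim: "?c (U 1) \<in> carrier_mat (n 1) (r {1})" and U2_dim: "?c (U 2) \<in> carrier_mat (n 2) (r {2})"
    using bspec[OF U_dim, of 1] bspec[OF U_dim, of 2] k by auto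
  have one: "1\<^sub>m s \<in> carrier_mat s s" for s :: nat by simp

  have svd': "Uj j \<in> carrier_mat (r {1}) s" "orthonormal_cols (Uj j)"
      "Vj j \<in> carrier_mat (r {2}) s" "orthonormal_cols (Vj j)"
      "Sj j \<in> carrier_mat s s" "diagonal_mat (Sj j)" "\<forall>i<s. 0 \<le> Sj j $$ (i, i)"
      "G j = Uj j * ?c (Sj j) * mat_adjoint (Vj j)"
    if "j \<in> freqs k n" for j
  proof -
    have "G j \<in> carrier_mat (r {1}) (r {2})" unfolding G[OF that] by (rule htd_core_carrier)
    with svd[OF that] show "Uj j \<in> carrier_mat (r {1}) s" "orthonormal_cols (Uj j)"
      "Vj j \<in> carrier_mat (r {2}) s" "orthonormal_cols (Vj j)"
      "Sj j \<in> carrier_mat s s" "diagonal_mat (Sj j)" "\<forall>i<s. 0 \<le> Sj j $$ (i, i)"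
      "G j = Uj j * ?c (Sj j) * mat_adjoint (Vj j)"
      by (auto simp: padded_svd_def)
  qed

  note X\<U> = hosvd_tensor[OF U1_dim one[of s] n, where M = Uj, folded \<rho>U LU BU, folded \<U>]
  note X\<S> = hosvd_tensor[OF one[of s] one[of s] n, where M = "\<lambda>j. ?c (Sj j)", folded \<rho>S LS BS, folded \<S>]
  note X\<V> = hosvd_tensor[OF U2_dim one[of s] n, where M = Vj, folded \<rho>V LV BV, folded \<V>]
  have face\<U>: "face (fourier \<U>) j = ?c (U 1) * Uj j" if "j \<in> freqs k n" for j
    using X\<U>(3)[OF that svd'(1)[OF that]] right_mult_one_mat[OF mult_carrier_mat[OF U1_dim svd'(1)[OF that]]] by simp
  have face\<S>: "face (fourier \<S>) j = ?c (Sj j)" if "j \<in> freqs k n" for j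
    using X\<S>(3)[OF that] svd'(5)[OF that] by simp
  have face\<V>: "face (fourier \<V>) j = ?c (U 2) * Vj j" if "j \<in> freqs k n" for j
    using X\<V>(3)[OF that svd'(3)[OF that]] right_mult_one_mat[OF mult_carrier_mat[OF U2_dim svd'(3)[OF that]]] by simp

  let ?H = "htd_tensor k \<T> r (\<lambda>t. ?c (U t)) B"
  note H = face_htd_tensor(1)[OF modes_tree k2 U_dim, of B]
  note US = face_fourier_tprod[OF X\<U>(1) X\<S>(1) k2 n] and Vt = face_fourier_ttranspose[OF X\<V>(1) k2 n]
  note USV = face_fourier_tprod[OF US(1) Vt(1) k2 n]
  \<comment> \<open>Entries at multi-indices out of range are arbitrary, so the given tensor need not be equal to
    the tensor of its network.\<close>
  have "?T \<doteq> ?H"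
    unfolding tensor_eq_def
  proof
    show "?T \<in> tensor_carrier (torder ?H) (tsize ?H)"
      using H T_ord T_ts by (auto simp: tensor_carrier_def)
    have "tindex ?H = tindex ?T"
      unfolding tindex_def T_ord using H T_ts by (auto simp: tensor_carrier_def intro!: PiE_cong)
    with T_entry show "\<forall>i\<in>tindex ?H. tentry ?T i = tentry ?H i" by (simp add: htd_tensor_def)
  qed
  moreover have "?H \<doteq> \<U> \<star>\<^sub>H \<S> \<star>\<^sub>H ttranspose \<V>"
  proof (rule tensor_eqI_fourier_faces[OF H USV(1) k2 n])
    fix j assume j: "j \<in> freqs k n"
    let ?A = "?c (U 1)" and ?C = "?c (U 2)" and ?S = "?c (Sj j)"
    have dims: "?S \<in> carrier_mat s s" "mat_adjoint (Vj j) \<in> carrier_mat s (r {2})"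
      "transpose_mat ?C \<in> carrier_mat (r {2}) (n 2)" "Uj j \<in> carrier_mat (r {1}) s"
      using svd'[OF j] U2_dim mat_adjoint_carrier by auto
    have "htd_core \<T> r (\<lambda>t. dft_mat (n t) * ?c (U t)) B j = G j"
      unfolding G[OF j]
    proof (rule htd_core_cong)
      fix t assume "t \<in> modes \<T> - {1, 2}"
      then have "t \<in> {3..k}" unfolding modes_tree by force
      then show "dft_mat (n t) * ?c (U t) = U_tilde t" by (simp only: U_tilde)
    qed
    then have "face (fourier ?H) j = ?A * (Uj j * ?S * mat_adjoint (Vj j)) * transpose_mat ?C"
      unfolding face_fourier_htd_tensor[OF modes_tree k2 U_dim j] using svd'(8)[OF j] by simp
    also have "\<dots> = (?A * Uj j) * ?S * (mat_adjoint (Vj j) * transpose_mat ?C)"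
    proof -
      note m = mult_carrier_mat
      have "?A * (Uj j * ?S * mat_adjoint (Vj j)) = ?A * Uj j * ?S * mat_adjoint (Vj j)"
        using assoc_mult_mat[OF U1_dim m[OF dims(4,1)] dims(2)]
          assoc_mult_mat[OF U1_dim dims(4,1)] by simp
      then show ?thesis
        using assoc_mult_mat[OF m[OF m[OF U1_dim dims(4)] dims(1)] dims(2,3)] by simp
    qed
    also have "\<dots> = face (fourier (\<U> \<star>\<^sub>H \<S> \<star>\<^sub>H ttranspose \<V>)) j"
      unfolding USV(2)[OF j] US(2)[OF j] Vt(2)[OF j] face\<U>[OF j] face\<S>[OF j] face\<V>[OF j]
        mat_adjoint_mult[OF U2_dim svd'(3)[OF j]] mat_adjoint_of_real ..
    finally show "face (fourier ?H) j = face (fourier (\<U> \<star>\<^sub>H \<S> \<star>\<^sub>H ttranspose \<V>)) j" .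
  qed
  ultimately have T_eq: "?T \<doteq> \<U> \<star>\<^sub>H \<S> \<star>\<^sub>H ttranspose \<V>" by (rule tensor_eq_trans)

  have "orthonormal_cols (face (fourier \<U>) j) \<and> orthonormal_cols (face (fourier \<V>) j) \<and>
      diagonal_mat (face (fourier \<S>) j) \<and>
      (\<forall>i<s. \<exists>\<sigma>\<ge>0. face (fourier \<S>) j $$ (i, i) = complex_of_real \<sigma>)"
    if j: "j \<in> freqs k n" for j
    unfolding face\<U>[OF j] face\<S>[OF j] face\<V>[OF j]
  proof (intro conjI)
    show "orthonormal_cols (?c (U 1) * Uj j)"
      by (rule orthonormal_cols_mult[OF U1_dim svd'(1)[OF j] orthonormal_cols_of_real[OF U1] svd'(2)[OF j]])
    show "orthonormal_cols (?c (U 2) * Vj j)"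
      by (rule orthonormal_cols_mult[OF U2_dim svd'(3)[OF j] orthonormal_cols_of_real[OF U2] svd'(4)[OF j]])
    show "diagonal_mat (?c (Sj j))" using svd'(6)[OF j] by (simp add: diagonal_mat_def)
    show "\<forall>i<s. \<exists>\<sigma>\<ge>0. ?c (Sj j) $$ (i, i) = complex_of_real \<sigma>" using svd'(5,7)[OF j] by auto
  qed
  with X\<U>(1,2) X\<S>(1,2) X\<V>(1,2) T_eq show ?thesis by simp
qed

end
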